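(* Fix integers $d\ge k>0$ with $d\ge 4$. Let $E\subset \mathbb{CP}^3$ be a union of $k$ pairwise disjoint lines. Then a general $Y\in |\mathcal{I}_E(d)|$ is a smooth degree $d$ hypersurface containing $E$ and containing no line $L\subset \mathbb{CP}^3$ with $L\cap E=\emptyset$.
   Context: For a closed subscheme $A\subset\mathbb{CP}^3$, $\mathcal{I}_A\subseteq\mathcal{O}_{\mathbb{CP}^3}$ denotes its ideal sheaf, $\mathcal{I}_A(d)=\mathcal{I}_A\otimes\mathcal{O}_{\mathbb{CP}^3}(d)$, and $|\mathcal{I}_A(d)|$ denotes the projective space associated to the vector space $H^0(\mathbb{CP}^3,\mathcal{I}_A(d))$, i.e. the set of degree $d$ surfaces in $\mathbb{CP}^3$ (possibly reducible or with multiple components) containing $A$. "A general $Y\in|\mathcal{I}_E(d)|$ has a property" means that the property holds for all $Y$ in some non-empty Zariski open subset of $|\mathcal{I}_E(d)|$. *)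

theory Defs
  imports "HOL-Analysis.Analysis" "HOL-Library.Poly_Mapping"
begin

section \<open>Complex polynomials in several variables\<close>

text \<open>
  A polynomial with variables indexed by \<open>'i\<close> is a finitely supported map from monomials
  (finitely supported exponent vectors) to coefficients. The index type may be infinite; below it
  is also the type of monomials of another polynomial ring, so as to speak of polynomials in the
  coefficients of a form.
\<close>

type_synonym 'i cpoly = "('i \<Rightarrow>\<^sub>0 nat) \<Rightarrow>\<^sub>0 complex"

definition eval_cpoly :: "('i \<Rightarrow> complex) \<Rightarrow> 'i cpoly \<Rightarrow> complex" where
  "eval_cpoly x F =
     (\<Sum>m\<in>Poly_Mapping.keys F.
        Poly_Mapping.lookup F m * (\<Prod>i\<in>Poly_Mapping.keys m. x i ^ Poly_Mapping.lookup m i))"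

definition partial_cpoly :: "'i \<Rightarrow> 'i cpoly \<Rightarrow> 'i cpoly" where
  "partial_cpoly i F =
     (\<Sum>m\<in>Poly_Mapping.keys F.
        Poly_Mapping.single (m - Poly_Mapping.single i 1)
          (of_nat (Poly_Mapping.lookup m i) * Poly_Mapping.lookup F m))"

text \<open>The zero polynomial is homogeneous of every degree.\<close>

definition homogeneous :: "nat \<Rightarrow> 'i cpoly \<Rightarrow> bool" where
  "homogeneous n F \<longleftrightarrow>
     (\<forall>m\<in>Poly_Mapping.keys F. (\<Sum>i\<in>Poly_Mapping.keys m. Poly_Mapping.lookup m i) = n)"


section \<open>Projective spaces\<close>

text \<open>
  The projective space of a complex vector space \<open>V\<close> with scalar multiplication \<open>s\<close>. A point is
  the set of all nonzero multiples of a nonzero vector, that is, a one-dimensional subspace with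
  the origin removed; its elements are its homogeneous coordinate vectors.
\<close>

definition proj_class :: "(complex \<Rightarrow> 'v \<Rightarrow> 'v) \<Rightarrow> 'v \<Rightarrow> 'v set" where
  "proj_class s v = {s c v | c. c \<noteq> 0}"

definition projectivization :: "(complex \<Rightarrow> 'v \<Rightarrow> 'v) \<Rightarrow> 'v::zero set \<Rightarrow> 'v set set" where
  "projectivization s V = proj_class s ` (V - {0})"

definition CP3 :: "(complex ^ 4) set set" where
  "CP3 = projectivization (*s) UNIV"

definition is_line :: "(complex ^ 4) set set \<Rightarrow> bool" where
  "is_line L \<longleftrightarrow> (\<exists>W. vec.subspace W \<and> vec.dim W = 2 \<and> L = projectivization (*s) W)"

definition fs_scale :: "complex \<Rightarrow> ('j \<Rightarrow>\<^sub>0 complex) \<Rightarrow> ('j \<Rightarrow>\<^sub>0 complex)" where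
  "fs_scale c v = Poly_Mapping.map ((*) c) v"

text \<open>
  Zariski open subsets of the projective space \<open>X = projectivization fs_scale V\<close> of a
  finite-dimensional subspace \<open>V\<close> of \<open>'j \<Rightarrow>\<^sub>0 complex\<close>: complements of common zero loci of
  arbitrary families of homogeneous polynomials in the coordinates of \<open>'j \<Rightarrow>\<^sub>0 complex\<close>. Every
  linear form on \<open>V\<close> is a linear combination of finitely many of these coordinates, so this is
  the same as using homogeneous polynomials in coordinates with respect to a basis of \<open>V\<close>.
\<close>

definition zariski_open :: "('j \<Rightarrow>\<^sub>0 complex) set set \<Rightarrow> ('j \<Rightarrow>\<^sub>0 complex) set set \<Rightarrow> bool" where
  "zariski_open X U \<longleftrightarrow>
     (\<exists>S :: 'j cpoly set. (\<forall>G\<in>S. \<exists>n. homogeneous n G) \<and>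
        U = {Y \<in> X. \<exists>G\<in>S. \<forall>F\<in>Y. eval_cpoly (Poly_Mapping.lookup F) G \<noteq> 0})"


section \<open>Surfaces in complex projective three-space\<close>

text \<open>
  The space of global sections of \<open>\<O>(d)\<close> on projective space is the space of forms of degree \<open>d\<close>.
  For a reduced closed subscheme with set of points \<open>A\<close>, the sections of its twisted ideal sheaf
  are the forms vanishing at all points of \<open>A\<close>.
\<close>

definition ideal_sections :: "(complex ^ 4) set set \<Rightarrow> nat \<Rightarrow> 4 cpoly set" where
  "ideal_sections A d =
     {F. homogeneous d F \<and> (\<forall>p\<in>A. \<forall>x\<in>p. eval_cpoly (($) x) F = 0)}"

definition linear_system :: "(complex ^ 4) set set \<Rightarrow> nat \<Rightarrow> 4 cpoly set set" where
  "linear_system A d = projectivization fs_scale (ideal_sections A d)"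

text \<open>
  A surface of degree \<open>d\<close>, possibly reducible or with multiple components, is a nonzero form of
  degree \<open>d\<close> up to nonzero scalars.
\<close>

definition degree_surfaces :: "nat \<Rightarrow> 4 cpoly set set" where
  "degree_surfaces d = projectivization fs_scale {F. homogeneous d F}"

definition surface_points :: "4 cpoly set \<Rightarrow> (complex ^ 4) set set" where
  "surface_points Y = {p \<in> CP3. \<forall>F\<in>Y. \<forall>x\<in>p. eval_cpoly (($) x) F = 0}"

text \<open>
  Smoothness of the surface as a scheme, by the Jacobian criterion for the defining form; in
  particular a surface with a multiple component is not smooth.
\<close>

definition smooth_surface :: "4 cpoly set \<Rightarrow> bool" where
  "smooth_surface Y \<longleftrightarrow>
     (\<forall>p\<in>surface_points Y. \<forall>F\<in>Y. \<forall>x\<in>p. \<exists>i. eval_cpoly (($) x) (partial_cpoly i F) \<noteq> 0)"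

definition general_member ::
    "(complex ^ 4) set set \<Rightarrow> nat \<Rightarrow> (4 cpoly set \<Rightarrow> bool) \<Rightarrow> bool" where
  "general_member A d P \<longleftrightarrow>
     (\<exists>U. zariski_open (linear_system A d) U \<and> U \<noteq> {} \<and> (\<forall>Y\<in>U. P Y))"

end

theory Submission
  imports Defs
begin

text \<open>
  Forms of degree \<open>d\<close> through \<open>E\<close> make up a space \<open>V\<close> of dimension \<open>N\<close>. A bad form satisfies, for
  some parameter \<open>t \<in> \<complex>\<^sup>m\<close>, a system of \<open>r > m\<close> linear conditions that are linearly independent on
  \<open>V\<close> and polynomial in \<open>t\<close>: vanishing at five points of a line (\<open>m = 4\<close>, \<open>r = 5\<close>), being
  singular at a point of \<open>E\<close> (\<open>m = 1\<close>, \<open>r = 2\<close>) or at a point off \<open>E\<close> (\<open>m = 3\<close>, \<open>r = 4\<close>).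
  Independence is tested on products of linear forms vanishing on the given lines. The last count
  fails only if \<open>k = d\<close> and the point lies on a common transversal of the lines; such points lie on
  the quadric through three of the lines, which is rational, so that \<open>m = 2\<close> and \<open>r = 3\<close> suffice.

  No elimination theory is needed to place such a family in a hypersurface. Solving the linear
  conditions parametrizes it by \<open>t\<close> and, homogeneously, \<open>N - r\<close> of the coordinates, so the
  monomials of degree \<open>D\<close> in the coordinates of \<open>V\<close> span, restricted to the family, a space of dimension \<open>O(D ^ (N - 2))\<close>, whereas
  there are of the order of \<open>D ^ (N - 1)\<close> of them. Hence some form of degree \<open>D\<close> vanishes on all bad
  forms, and its complement is the required open set.
\<close>

section \<open>Sets with few independent monomials\<close>

text \<open>The exponent \<open>N - 2\<close> comes from a count: after substitution of the
  parametrization, a monomial of degree \<open>D\<close> has degree \<open>O(D)\<close> in each of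
  \<open>m\<close> parameters and is homogeneous of degree \<open>D\<close> in \<open>N - r\<close>
  unknowns, so \<open>O(D ^ (m + N - r - 1))\<close> mixed monomials suffice, and
  \<open>r > m\<close> is what makes this small enough. The test products explain the hypotheses:
  \<open>k \<le> d\<close> supplies one linear factor per line, and \<open>d \<ge> 4\<close>
  supplies four factors, one for each point from which a fifth point of a line is to be separated.
  Five is one more than the dimension 4 of the family of lines. The obstacle is a point on a line
  meeting all of \<open>d\<close> given lines. A form of degree \<open>d\<close> through them
  restricts to that transversal as a form with \<open>d\<close> prescribed zeros, unique up to a
  factor, so its value and its derivative along the transversal are dependent and one of the four
  conditions is lost. Since then \<open>k = d \<ge> 4\<close>, three lines are available to span a
  quadric. Euler's identity turns values into radial derivatives, which gives all conditions one
  shape.\<close>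

lemma homogeneous_system_nontrivial:
  fixes M :: "'b \<Rightarrow> 'a \<Rightarrow> 'f::field"
  assumes "finite B" "finite A" "card B < card A"
  shows "\<exists>g. (\<exists>a\<in>A. g a \<noteq> 0) \<and> (\<forall>b\<in>B. (\<Sum>a\<in>A. g a * M b a) = 0)"
  using assms
proof (induction B arbitrary: A M rule: finite_induct)
  case empty
  then obtain a where "a \<in> A" by fastforce
  then show ?case by (intro exI[of _ "\<lambda>_. 1"]) auto
next
  case (insert b B)
  show ?case
  proof (cases "\<forall>a\<in>A. M b a = 0")
    case True
    have "card B < card A" using insert by simp
    then obtain g where "\<exists>a\<in>A. g a \<noteq> 0" "\<forall>b\<in>B. (\<Sum>a\<in>A. g a * M b a) = 0"
      using insert.IH[OF insert.prems(1)] by blast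
    then show ?thesis using True by (intro exI[of _ g]) auto
  next
    case False
    then obtain a0 where a0: "a0 \<in> A" "M b a0 \<noteq> 0" by blast
    define A' where "A' = A - {a0}"
    have fA': "finite A'" and A: "A = insert a0 A'" "a0 \<notin> A'"
      using a0 insert.prems by (auto simp: A'_def)
    then have "card B < card A'" using insert by auto
    then obtain g where g: "\<exists>a\<in>A'. g a \<noteq> 0"
      "\<forall>c\<in>B. (\<Sum>a\<in>A'. g a * (M c a - M c a0 * M b a / M b a0)) = 0"
      using insert.IH[OF fA', of "\<lambda>c a. M c a - M c a0 * M b a / M b a0"] by blast
    define s where "s = (\<Sum>a\<in>A'. g a * M b a) / M b a0"
    define h where "h = g(a0 := - s)"
    have h: "(\<Sum>a\<in>A. h a * M c a) = (\<Sum>a\<in>A'. g a * M c a) - s * M c a0" for c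
    proof -
      have "(\<Sum>a\<in>A'. h a * M c a) = (\<Sum>a\<in>A'. g a * M c a)"
        by (intro sum.cong) (use A in \<open>auto simp: h_def\<close>)
      then show ?thesis using A fA' by (simp add: h_def)
    qed
    have "(\<Sum>a\<in>A. h a * M b a) = 0"
      using a0 by (simp add: h s_def)
    moreover have "(\<Sum>a\<in>A. h a * M c a) = 0" if "c \<in> B" for c
    proof -
      have "0 = (\<Sum>a\<in>A'. g a * M c a - M c a0 / M b a0 * (g a * M b a))"
        using bspec[OF g(2) that] by (simp add: algebra_simps)
      also have "\<dots> = (\<Sum>a\<in>A'. g a * M c a) - M c a0 / M b a0 * (\<Sum>a\<in>A'. g a * M b a)"
        by (simp add: sum_subtractf sum_distrib_left)
      finally show ?thesis by (simp add: h s_def)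
    qed
    moreover have "\<exists>a\<in>A. h a \<noteq> 0" using g(1) A by (auto simp: h_def)
    ultimately show ?thesis by (intro exI[of _ h]) auto
  qed
qed

text \<open>Distinct monomials are linearly independent as functions. The terms with the same
  exponent of \<open>j\<close> as \<open>a0\<close> have a nonzero sum at some \<open>c\<close> by
  induction; this sum is a coefficient of a polynomial in the variable \<open>j\<close> alone, which
  therefore has a non-root.\<close>

lemma monomial_combination_nonzero:
  fixes e :: "'x \<Rightarrow> 'j \<Rightarrow> nat" and g :: "'x \<Rightarrow> complex"
  assumes "finite J" "finite A" "\<And>a b. \<lbrakk>a \<in> A; b \<in> A; \<forall>j\<in>J. e a j = e b j\<rbrakk> \<Longrightarrow> a = b"
    "a0 \<in> A" "g a0 \<noteq> 0"
  shows "\<exists>c. (\<Sum>a\<in>A. g a * (\<Prod>j\<in>J. c j ^ e a j)) \<noteq> 0"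
  using assms
proof (induction J arbitrary: A rule: finite_induct)
  case empty
  then have "A = {a0}" by auto
  then show ?case using empty by simp
next
  case (insert j J)
  define A0 where "A0 = {a\<in>A. e a j = e a0 j}"
  have "\<exists>c. (\<Sum>a\<in>A0. g a * (\<Prod>j\<in>J. c j ^ e a j)) \<noteq> 0"
    by (rule insert.IH) (use insert.prems in \<open>auto simp: A0_def\<close>)
  then obtain c where c: "(\<Sum>a\<in>A0. g a * (\<Prod>j\<in>J. c j ^ e a j)) \<noteq> 0" by blast
  define p where "p = (\<Sum>a\<in>A. monom (g a * (\<Prod>j\<in>J. c j ^ e a j)) (e a j))"
  have "coeff p (e a0 j) = (\<Sum>a\<in>A. if e a j = e a0 j then g a * (\<Prod>j\<in>J. c j ^ e a j) else 0)"
    by (simp add: p_def coeff_sum)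
  also have "\<dots> = (\<Sum>a\<in>A0. g a * (\<Prod>j\<in>J. c j ^ e a j))"
    unfolding A0_def by (rule sum.inter_filter[symmetric]) (rule insert.prems)
  finally have "p \<noteq> 0" using c by auto
  then have "finite {z. poly p z = 0}" by (rule poly_roots_finite)
  then obtain z where z: "poly p z \<noteq> 0"
    using infinite_UNIV_char_0 by (metis (mono_tags, lifting) Collect_cong UNIV_I UNIV_def)
  have "poly p z = (\<Sum>a\<in>A. g a * (\<Prod>i\<in>insert j J. (c(j := z)) i ^ e a i))"
  proof -
    have "(\<Prod>i\<in>J. (c(j := z)) i ^ e a i) = (\<Prod>i\<in>J. c i ^ e a i)" for a
      by (intro prod.cong) (use insert.hyps in auto)
    then show ?thesis using insert.hyps
      by (simp add: p_def poly_sum poly_monom mult_ac del: fun_upd_apply) (simp add: mult_ac)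
  qed
  with z show ?case by (intro exI[of _ "c(j := z)"]) auto
qed

section \<open>Thin sets and forms vanishing on them\<close>

definition exponents :: "'j set \<Rightarrow> nat \<Rightarrow> ('j \<Rightarrow>\<^sub>0 nat) set" where
  "exponents J D = {m. Poly_Mapping.keys m \<subseteq> J \<and> (\<Sum>j\<in>J. Poly_Mapping.lookup m j) = D}"

text \<open>The Hilbert function of the cone over a thin set grows at most like \<open>D ^ (card J - 2)\<close>. The
  elements of \<open>\<Lambda>\<close> are vectors indexed by exponents; they span all vectors of monomial values.\<close>

definition thin :: "'j set \<Rightarrow> ('j \<Rightarrow> complex) set \<Rightarrow> bool" where
  "thin J B \<longleftrightarrow> (\<exists>K. \<forall>D\<ge>1. \<exists>\<Lambda>. finite \<Lambda> \<and> card \<Lambda> * (D + 1)\<^sup>2 \<le> K * (D + 1) ^ card J \<and>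
     (\<forall>c\<in>B. \<exists>h. \<forall>m\<in>exponents J D.
        (\<Prod>j\<in>J. c j ^ Poly_Mapping.lookup m j) = (\<Sum>v\<in>\<Lambda>. h v * v m)))"

lemma thin_subset: "thin J B \<Longrightarrow> A \<subseteq> B \<Longrightarrow> thin J A"
  unfolding thin_def by (meson subset_iff)

lemma thin_empty: "thin J {}"
  unfolding thin_def by (rule exI[of _ 0]) auto

text \<open>Spanning families are united and the constants add up: thinness bounds a growth rate, so
  passing to finitely many charts and cases costs nothing.\<close>

lemma thin_Un:
  assumes "thin J A" "thin J B" shows "thin J (A \<union> B)"
proof -
  from assms obtain K1 K2 where
    K1: "\<And>D. D \<ge> 1 \<Longrightarrow> \<exists>\<Lambda>. finite \<Lambda> \<and> card \<Lambda> * (D + 1)\<^sup>2 \<le> K1 * (D + 1) ^ card J \<and>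
     (\<forall>c\<in>A. \<exists>h. \<forall>m\<in>exponents J D.
        (\<Prod>j\<in>J. c j ^ Poly_Mapping.lookup m j) = (\<Sum>v\<in>\<Lambda>. h v * v m))" and
    K2: "\<And>D. D \<ge> 1 \<Longrightarrow> \<exists>\<Lambda>. finite \<Lambda> \<and> card \<Lambda> * (D + 1)\<^sup>2 \<le> K2 * (D + 1) ^ card J \<and>
     (\<forall>c\<in>B. \<exists>h. \<forall>m\<in>exponents J D.
        (\<Prod>j\<in>J. c j ^ Poly_Mapping.lookup m j) = (\<Sum>v\<in>\<Lambda>. h v * v m))"
    unfolding thin_def by blast
  show ?thesis unfolding thin_def
  proof (intro exI[of _ "K1 + K2"] allI impI)
    fix D :: nat assume D: "D \<ge> 1"
    obtain \<Lambda>1 where L1: "finite \<Lambda>1" "card \<Lambda>1 * (D + 1)\<^sup>2 \<le> K1 * (D + 1) ^ card J"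
     "\<And>c. c\<in>A \<Longrightarrow> \<exists>h. \<forall>m\<in>exponents J D.
        (\<Prod>j\<in>J. c j ^ Poly_Mapping.lookup m j) = (\<Sum>v\<in>\<Lambda>1. h v * v m)" using K1[OF D] by blast
    obtain \<Lambda>2 where L2: "finite \<Lambda>2" "card \<Lambda>2 * (D + 1)\<^sup>2 \<le> K2 * (D + 1) ^ card J"
     "\<And>c. c\<in>B \<Longrightarrow> \<exists>h. \<forall>m\<in>exponents J D.
        (\<Prod>j\<in>J. c j ^ Poly_Mapping.lookup m j) = (\<Sum>v\<in>\<Lambda>2. h v * v m)" using K2[OF D] by blast
    have ext: "\<exists>h'. \<forall>m\<in>exponents J D. x m = (\<Sum>v\<in>\<Lambda>1 \<union> \<Lambda>2. h' v * v m)"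
      if "\<exists>h. \<forall>m\<in>exponents J D. x m = (\<Sum>v\<in>\<Lambda>. h v * v m)" "\<Lambda> \<subseteq> \<Lambda>1 \<union> \<Lambda>2"
      for x :: "('a \<Rightarrow>\<^sub>0 nat) \<Rightarrow> complex" and \<Lambda>
    proof -
      from that(1) obtain h where h: "\<forall>m\<in>exponents J D. x m = (\<Sum>v\<in>\<Lambda>. h v * v m)" by blast
      have "(\<Sum>v\<in>\<Lambda>1 \<union> \<Lambda>2. (if v \<in> \<Lambda> then h v else 0) * v m) = (\<Sum>v\<in>\<Lambda>. h v * v m)" for m
        by (rule sum.mono_neutral_cong_right) (use L1 L2 that(2) in auto)
      then show ?thesis using h by (intro exI[of _ "\<lambda>l. if l \<in> \<Lambda> then h l else 0"]) auto
    qed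
    have "card (\<Lambda>1 \<union> \<Lambda>2) * (D + 1)\<^sup>2 \<le> (card \<Lambda>1 + card \<Lambda>2) * (D + 1)\<^sup>2"
      by (rule mult_right_mono) (auto simp: card_Un_le)
    then have "card (\<Lambda>1 \<union> \<Lambda>2) * (D + 1)\<^sup>2 \<le> (K1 + K2) * (D + 1) ^ card J"
      using L1 L2 by (simp add: algebra_simps)
    moreover have "\<exists>h. \<forall>m\<in>exponents J D.
        (\<Prod>j\<in>J. c j ^ Poly_Mapping.lookup m j) = (\<Sum>v\<in>\<Lambda>1 \<union> \<Lambda>2. h v * v m)"
      if "c \<in> A \<union> B" for c
      using that ext[OF L1(3), of c] ext[OF L2(3), of c] by blast
    ultimately show "\<exists>\<Lambda>. finite \<Lambda> \<and> card \<Lambda> * (D + 1)\<^sup>2 \<le> (K1 + K2) * (D + 1) ^ card J \<and>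
     (\<forall>c\<in>A \<union> B. \<exists>h. \<forall>m\<in>exponents J D.
        (\<Prod>j\<in>J. c j ^ Poly_Mapping.lookup m j) = (\<Sum>v\<in>\<Lambda>. h v * v m))"
      using L1 L2 by (intro exI[of _ "\<Lambda>1 \<union> \<Lambda>2"]) auto
  qed
qed

lemma thin_UN:
  assumes "finite I" "\<And>i. i \<in> I \<Longrightarrow> thin J (B i)"
  shows "thin J (\<Union>i\<in>I. B i)"
  using assms by (induction I rule: finite_induct) (auto intro: thin_empty thin_Un)

text \<open>All exponents but one are chosen freely in \<open>{..D}\<close> and the last one fills
  up the degree. The total degree \<open>card J * D\<close> is large enough for this remainder never
  to be negative.\<close>

lemma card_exponents:
  assumes "finite J" "J \<noteq> {}"
  shows "\<exists>A. finite A \<and> A \<subseteq> exponents J (card J * D) \<and> card A = (D + 1) ^ (card J - 1)"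
proof -
  from assms obtain i where i: "i \<in> J" by blast
  define J' where "J' = J - {i}"
  have J: "J = insert i J'" "i \<notin> J'" "finite J'" using i assms by (auto simp: J'_def)
  define \<phi> where "\<phi> f = Abs_poly_mapping (\<lambda>j. if j \<in> J' then f j else
      if j = i then card J * D - sum f J' else 0)" for f
  have lk: "Poly_Mapping.lookup (\<phi> f) = (\<lambda>j. if j \<in> J' then f j else
      if j = i then card J * D - sum f J' else 0)" for f
    unfolding \<phi>_def
    by (rule lookup_Abs_poly_mapping, rule finite_subset[of _ J]) (use J assms in auto)
  let ?X = "PiE J' (\<lambda>_. {..D})"
  have le: "sum f J' \<le> card J * D" if "f \<in> ?X" for f
  proof -
    have "sum f J' \<le> of_nat (card J') * D"
      by (rule sum_bounded_above) (use that in auto)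
    also have "\<dots> \<le> card J * D" using J by simp
    finally show ?thesis .
  qed
  have "inj_on \<phi> ?X"
  proof (rule inj_onI)
    fix f g assume fg: "f \<in> ?X" "g \<in> ?X" "\<phi> f = \<phi> g"
    have "f j = g j" if "j \<in> J'" for j
      using arg_cong[OF fg(3), of "\<lambda>p. Poly_Mapping.lookup p j"] that by (simp add: lk)
    then show "f = g" using fg by (metis PiE_ext)
  qed
  then have "card (\<phi> ` ?X) = (D + 1) ^ (card J - 1)"
    using J by (simp add: card_image card_PiE)
  moreover have "\<phi> ` ?X \<subseteq> exponents J (card J * D)"
  proof safe
    fix f assume f: "f \<in> ?X"
    have "Poly_Mapping.keys (\<phi> f) \<subseteq> J"
      using J(1) by (auto simp: in_keys_iff lk split: if_splits)
    moreover have "(\<Sum>j\<in>J'. Poly_Mapping.lookup (\<phi> f) j) = sum f J'"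
      by (rule sum.cong) (auto simp: lk)
    moreover have "Poly_Mapping.lookup (\<phi> f) i = card J * D - sum f J'"
      using J by (simp add: lk)
    ultimately show "\<phi> f \<in> exponents J (card J * D)"
      using J le[OF f] by (simp add: exponents_def)
  qed
  moreover have "finite (\<phi> ` ?X)" using J by (simp add: finite_PiE)
  ultimately show ?thesis by blast
qed

text \<open>For large \<open>D\<close> there are more exponents in \<open>A\<close> than vectors in
  \<open>\<Lambda>\<close>, so some nonzero \<open>g\<close> is orthogonal to all of
  \<open>\<Lambda>\<close>, hence to the monomial values of every point of \<open>B\<close>.
  Independence of monomials yields a point where the resulting form does not vanish.\<close>

lemma thin_avoiding_form:
  assumes "thin J B" "finite J" "J \<noteq> {}"
  obtains D A g c where "D \<ge> 1" "finite A" "A \<subseteq> exponents J D"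
    "\<forall>c\<in>B. (\<Sum>m\<in>A. g m * (\<Prod>j\<in>J. c j ^ Poly_Mapping.lookup m j)) = 0"
    "(\<Sum>m\<in>A. g m * (\<Prod>j\<in>J. c j ^ Poly_Mapping.lookup m j)) \<noteq> 0"
proof -
  from assms(1)[unfolded thin_def] obtain K where
    K: "\<forall>D\<ge>1. \<exists>\<Lambda>. finite \<Lambda> \<and> card \<Lambda> * (D + 1)\<^sup>2 \<le> K * (D + 1) ^ card J \<and>
     (\<forall>c\<in>B. \<exists>h. \<forall>m\<in>exponents J D.
        (\<Prod>j\<in>J. c j ^ Poly_Mapping.lookup m j) = (\<Sum>v\<in>\<Lambda>. h v * v m))"
    ..
  define N where "N = card J"
  have N: "N \<ge> 1" using assms by (simp add: N_def card_gt_0_iff Suc_leI)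
  \<comment> \<open>Large enough for \<open>D \<ge> D0\<close> to exceed
    \<open>K * N ^ (N - 1)\<close>. The factor \<open>N ^ (N - 1)\<close> is the price of comparing
    \<open>(D + 1) ^ (N - 1)\<close> with \<open>(D0 + 1) ^ (N - 1)\<close>, where
    \<open>D = N * D0\<close>.\<close>
  define D0 where "D0 = K * N ^ (N - 1) + 1"
  define D where "D = N * D0"
  have "D \<ge> 1" using N by (simp add: D_def D0_def)
  then obtain \<Lambda> where \<Lambda>: "finite \<Lambda>" "card \<Lambda> * (D + 1)\<^sup>2 \<le> K * (D + 1) ^ N"
     "\<And>c. c\<in>B \<Longrightarrow> \<exists>h. \<forall>m\<in>exponents J D.
        (\<Prod>j\<in>J. c j ^ Poly_Mapping.lookup m j) = (\<Sum>v\<in>\<Lambda>. h v * v m)"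
    using K[rule_format, of D] unfolding N_def by blast
  obtain A where A: "finite A" "A \<subseteq> exponents J D" "card A = (D0 + 1) ^ (N - 1)"
    using card_exponents[OF assms(2,3), of D0] by (auto simp: D_def N_def)
  have "card \<Lambda> < card A"
  proof (rule ccontr)
    assume "\<not> card \<Lambda> < card A"
    then have *: "(D0 + 1) ^ (N - 1) \<le> card \<Lambda>" using A by simp
    have DN: "D + 1 \<le> N * (D0 + 1)" using N by (simp add: D_def)
    have "(D + 1) ^ (N - 1) * (D + 1)\<^sup>2 \<le> (N * (D0 + 1)) ^ (N - 1) * (D + 1)\<^sup>2"
      by (intro mult_right_mono power_mono DN) auto
    also have "\<dots> = N ^ (N - 1) * ((D0 + 1) ^ (N - 1) * (D + 1)\<^sup>2)"
      by (simp only: power_mult_distrib mult.assoc)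
    also have "\<dots> \<le> N ^ (N - 1) * (card \<Lambda> * (D + 1)\<^sup>2)"
      by (intro mult_left_mono mult_right_mono *) auto
    also have "\<dots> \<le> N ^ (N - 1) * (K * (D + 1) ^ N)"
      by (intro mult_left_mono \<Lambda>) auto
    finally have "(D + 1) ^ N * (D + 1) \<le> (D + 1) ^ N * (K * N ^ (N - 1))"
      using N by (cases N) (simp_all add: power2_eq_square algebra_simps)
    then have "D + 1 \<le> K * N ^ (N - 1)" by (simp only: mult_le_cancel1) auto
    moreover have "K * N ^ (N - 1) + 1 \<le> D" unfolding D_def D0_def using N
      by (metis mult_le_mono1 nat_mult_1)
    ultimately show False by simp
  qed
  from homogeneous_system_nontrivial[OF \<Lambda>(1) A(1) this, of "\<lambda>v. v"]
  obtain g a where g: "a \<in> A" "g a \<noteq> 0" "\<forall>b\<in>\<Lambda>. (\<Sum>a\<in>A. g a * b a) = 0" by blast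
  have van: "(\<Sum>m\<in>A. g m * (\<Prod>j\<in>J. c j ^ Poly_Mapping.lookup m j)) = 0" if cB: "c \<in> B" for c
  proof -
    obtain h where h: "\<forall>m\<in>exponents J D.
        (\<Prod>j\<in>J. c j ^ Poly_Mapping.lookup m j) = (\<Sum>v\<in>\<Lambda>. h v * v m)" using \<Lambda>(3)[OF cB] by blast
    have "(\<Sum>m\<in>A. g m * (\<Prod>j\<in>J. c j ^ Poly_Mapping.lookup m j)) =
        (\<Sum>m\<in>A. \<Sum>v\<in>\<Lambda>. h v * (g m * v m))"
      by (rule sum.cong) (use A(2) h in \<open>auto simp: sum_distrib_left mult_ac\<close>)
    also have "\<dots> = (\<Sum>v\<in>\<Lambda>. h v * (\<Sum>m\<in>A. g m * v m))"
      by (subst sum.swap) (simp add: sum_distrib_left)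
    also have "\<dots> = 0" using g(3) by simp
    finally show ?thesis .
  qed
  have "\<exists>c. (\<Sum>m\<in>A. g m * (\<Prod>j\<in>J. c j ^ Poly_Mapping.lookup m j)) \<noteq> 0"
  proof (rule monomial_combination_nonzero[where g = g and ?a0.0 = a, OF assms(2) A(1) _ g(1) g(2)])
    fix m m' assume m: "m \<in> A" "m' \<in> A" "\<forall>j\<in>J. Poly_Mapping.lookup m j = Poly_Mapping.lookup m' j"
    have "Poly_Mapping.lookup m j = Poly_Mapping.lookup m' j" for j
    proof (cases "j \<in> J")
      case False
      then have "j \<notin> Poly_Mapping.keys m" "j \<notin> Poly_Mapping.keys m'"
        using m A(2) by (auto simp: exponents_def)
      then show ?thesis by (simp add: in_keys_iff)
    qed (use m in auto)
    then show "m = m'" by (simp add: poly_mapping_eqI)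
  qed
  then show ?thesis using that[OF \<open>D \<ge> 1\<close> A(1,2)] van by blast
qed

section \<open>Families with a polynomial parametrization are thin\<close>

text \<open>Polynomials in the first \<open>m\<close> parameters, taken as functions: the proof uses
  only closure under ring operations and, by induction over this set, the existence of a degree
  bound.\<close>

inductive_set polyf :: "nat \<Rightarrow> ((nat \<Rightarrow> complex) \<Rightarrow> complex) set" for m :: nat where
  const: "(\<lambda>_. c) \<in> polyf m"
| var: "i < m \<Longrightarrow> (\<lambda>t. t i) \<in> polyf m"
| add: "f \<in> polyf m \<Longrightarrow> g \<in> polyf m \<Longrightarrow> (\<lambda>t. f t + g t) \<in> polyf m"
| mult: "f \<in> polyf m \<Longrightarrow> g \<in> polyf m \<Longrightarrow> (\<lambda>t. f t * g t) \<in> polyf m"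

lemma polyf_diff:
  assumes "f \<in> polyf m" "g \<in> polyf m" shows "(\<lambda>t. f t - g t) \<in> polyf m"
  using polyf.add[OF assms(1) polyf.mult[OF polyf.const[of "-1"] assms(2)]] by simp

lemma polyf_sum: "(\<And>i. i \<in> A \<Longrightarrow> f i \<in> polyf m) \<Longrightarrow> (\<lambda>t. \<Sum>i\<in>A. f i t) \<in> polyf m"
  by (induction A rule: infinite_finite_induct) (auto intro: polyf.intros)

lemma polyf_power: "f \<in> polyf m \<Longrightarrow> (\<lambda>t. f t ^ n) \<in> polyf m"
  by (induction n) (auto intro: polyf.intros)

lemma polyf_prod: "(\<And>i. i \<in> A \<Longrightarrow> f i \<in> polyf m) \<Longrightarrow> (\<lambda>t. \<Prod>i\<in>A. f i t) \<in> polyf m"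
  by (induction A rule: infinite_finite_induct) (auto intro: polyf.intros)

text \<open>The linear span of a finite \<open>S\<close>; for infinite \<open>S\<close> the sum
  defaults to 0.\<close>

definition lincombs :: "('y \<Rightarrow> complex) set \<Rightarrow> ('y \<Rightarrow> complex) set" where
  "lincombs S = {f. \<exists>M. \<forall>y. f y = (\<Sum>h\<in>S. M h * h y)}"

lemma lincombs_zero: "(\<lambda>_. 0) \<in> lincombs S"
  unfolding lincombs_def by (auto intro!: exI[of _ "\<lambda>_. 0"])

lemma lincombs_base: "finite S \<Longrightarrow> f \<in> S \<Longrightarrow> f \<in> lincombs S"
proof -
  assume "finite S" "f \<in> S"
  then have "(\<Sum>h\<in>S. (if h = f then 1 else 0) * h y) = f y" for y
    by (subst sum.mono_neutral_cong_right[of S "{f}" _ "\<lambda>h. h y"]) auto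
  then show ?thesis unfolding lincombs_def by (intro CollectI exI[of _ "\<lambda>h. if h = f then 1 else 0"]) simp
qed

lemma lincombs_add: "f \<in> lincombs S \<Longrightarrow> g \<in> lincombs S \<Longrightarrow> (\<lambda>y. f y + g y) \<in> lincombs S"
  unfolding lincombs_def
proof safe
  fix M M' assume "\<forall>y. f y = (\<Sum>h\<in>S. M h * h y)" "\<forall>y. g y = (\<Sum>h\<in>S. M' h * h y)"
  then show "\<exists>M. \<forall>y. f y + g y = (\<Sum>h\<in>S. M h * h y)"
    by (intro exI[of _ "\<lambda>h. M h + M' h"]) (simp add: algebra_simps sum.distrib)
qed

lemma lincombs_scale: "f \<in> lincombs S \<Longrightarrow> (\<lambda>y. c * f y) \<in> lincombs S"
  unfolding lincombs_def
proof safe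
  fix M assume "\<forall>y. f y = (\<Sum>h\<in>S. M h * h y)"
  then show "\<exists>M. \<forall>y. c * f y = (\<Sum>h\<in>S. M h * h y)"
    by (intro exI[of _ "\<lambda>h. c * M h"]) (simp add: sum_distrib_left mult.assoc)
qed

lemma lincombs_sum: "(\<And>i. i \<in> A \<Longrightarrow> f i \<in> lincombs S) \<Longrightarrow> (\<lambda>y. \<Sum>i\<in>A. f i y) \<in> lincombs S"
  by (induction A rule: infinite_finite_induct) (auto intro: lincombs_zero lincombs_add)

lemma lincombs_mono:
  assumes "finite T" "S \<subseteq> T" shows "lincombs S \<subseteq> lincombs T"
proof
  fix f assume "f \<in> lincombs S"
  then obtain M where M: "\<forall>y. f y = (\<Sum>h\<in>S. M h * h y)" unfolding lincombs_def by blast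
  have "f = (\<lambda>y. \<Sum>h\<in>S. M h * h y)" using M by auto
  also have "\<dots> \<in> lincombs T"
    by (intro lincombs_sum lincombs_scale lincombs_base assms) (use assms in auto)
  finally show "f \<in> lincombs T" .
qed

lemma lincombs_mult:
  assumes "finite R" "\<And>f g. f \<in> S \<Longrightarrow> g \<in> T \<Longrightarrow> (\<lambda>y. f y * g y) \<in> R"
    and "f \<in> lincombs S" "g \<in> lincombs T"
  shows "(\<lambda>y. f y * g y) \<in> lincombs R"
proof -
  obtain M M' where M: "\<forall>y. f y = (\<Sum>h\<in>S. M h * h y)" "\<forall>y. g y = (\<Sum>h\<in>T. M' h * h y)"
    using assms(3,4) unfolding lincombs_def by blast
  have "(\<lambda>y. f y * g y) = (\<lambda>y. \<Sum>h\<in>S. \<Sum>k\<in>T. (M h * M' k) * (h y * k y))"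
    unfolding M[rule_format] by (auto simp: sum_product intro!: sum.cong)
  also have "\<dots> \<in> lincombs R"
    by (intro lincombs_sum lincombs_scale lincombs_base assms(1,2))
  finally show ?thesis .
qed

text \<open>The parameters \<open>t\<close> carry only a degree bound, whereas the degree in
  \<open>c\<close> is exact. The elements are functions, so coincidences can only lower the
  cardinality.\<close>

definition mixed_monomials ::
    "nat \<Rightarrow> nat \<Rightarrow> 'j set \<Rightarrow> nat \<Rightarrow> ((nat \<Rightarrow> complex) \<times> ('j \<Rightarrow> complex) \<Rightarrow> complex) set" where
  "mixed_monomials m e J D =
     (\<lambda>(a, b) (t, c). (\<Prod>i<m. t i ^ a i) * (\<Prod>j\<in>J. c j ^ b j)) `
       ((PiE {..<m} (\<lambda>_. {..e})) \<times> {b \<in> PiE J (\<lambda>_. {..D}). sum b J = D})"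

lemma finite_mixed_monomials: "finite J \<Longrightarrow> finite (mixed_monomials m e J D)"
  unfolding mixed_monomials_def by (intro finite_imageI finite_cartesian_product)
    (auto simp: finite_PiE)

lemma mixed_monomials_mono: "e \<le> e' \<Longrightarrow> mixed_monomials m e J D \<subseteq> mixed_monomials m e' J D"
  unfolding mixed_monomials_def by (intro image_mono Sigma_mono PiE_mono) auto

lemma mixed_monomials_empty: "D \<ge> 1 \<Longrightarrow> mixed_monomials m e {} D = {}"
  by (auto simp: mixed_monomials_def)

lemma mixed_monomialI:
  assumes "finite J" "\<And>i. i < m \<Longrightarrow> a i \<le> e" "sum b J = D"
  shows "(\<lambda>(t, c). (\<Prod>i<m. t i ^ a i) * (\<Prod>j\<in>J. c j ^ b j)) \<in> mixed_monomials m e J D"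
proof -
  have "b j \<le> D" if "j \<in> J" for j
    using assms that by (metis member_le_sum zero_le)
  then have "(restrict a {..<m}, restrict b J) \<in>
    ((PiE {..<m} (\<lambda>_. {..e})) \<times> {b \<in> PiE J (\<lambda>_. {..D}). sum b J = D})"
    using assms by auto
  then have "(\<lambda>(a, b) (t, c). (\<Prod>i<m. t i ^ a i) * (\<Prod>j\<in>J. c j ^ b j))
     (restrict a {..<m}, restrict b J) \<in> mixed_monomials m e J D"
    unfolding mixed_monomials_def by (rule imageI)
  then show ?thesis by simp
qed

lemma mixed_monomialE:
  assumes "f \<in> mixed_monomials m e J D"
  obtains a b where "\<And>i. i < m \<Longrightarrow> a i \<le> e" "sum b J = D"
    "f = (\<lambda>(t, c). (\<Prod>i<m. t i ^ a i) * (\<Prod>j\<in>J. c j ^ b j))"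
proof -
  from assms obtain a b where "a \<in> PiE {..<m} (\<lambda>_. {..e})" "sum b J = D"
    "f = (\<lambda>(t, c). (\<Prod>i<m. t i ^ a i) * (\<Prod>j\<in>J. c j ^ b j))"
    unfolding mixed_monomials_def by auto
  then show ?thesis by (intro that[of a b]) (auto simp: PiE_iff)
qed

text \<open>Homogeneity in \<open>c\<close> saves one factor \<open>D + 1\<close>: exponents with
  sum \<open>D\<close> are determined by their values away from one index \<open>i\<close>.\<close>

lemma card_mixed_monomials:
  assumes "finite J" "J \<noteq> {}"
  shows "card (mixed_monomials m e J D) \<le> (e + 1) ^ m * (D + 1) ^ (card J - 1)"
proof -
  from assms obtain i where i: "i \<in> J" by blast
  define J' where "J' = J - {i}"
  have J: "J = insert i J'" "i \<notin> J'" "finite J'" using i assms by (auto simp: J'_def)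
  let ?B = "{b \<in> PiE J (\<lambda>_. {..D}). sum b J = D}"
  have "inj_on (\<lambda>b. restrict b J') ?B"
  proof (rule inj_onI)
    fix b b' assume b: "b \<in> ?B" "b' \<in> ?B" "restrict b J' = restrict b' J'"
    have eq: "b j = b' j" if "j \<in> J'" for j using b(3) that by (metis restrict_apply')
    then have "sum b J' = sum b' J'" by simp
    then have "b i = b' i" using b(1,2) J by auto
    with eq have "b j = b' j" if "j \<in> J" for j using that J by auto
    with b show "b = b'" by (metis (no_types, lifting) PiE_ext mem_Collect_eq)
  qed
  then have "card ?B = card ((\<lambda>b. restrict b J') ` ?B)" by (simp add: card_image)
  also have "\<dots> \<le> card (PiE J' (\<lambda>_. {..D}))"
    by (rule card_mono) (use J in \<open>auto simp: finite_PiE\<close>)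
  also have "\<dots> = (D + 1) ^ (card J - 1)" using J by (simp add: card_PiE)
  finally have B: "card ?B \<le> (D + 1) ^ (card J - 1)" .
  have "card (mixed_monomials m e J D) \<le> card ((PiE {..<m} (\<lambda>_. {..e})) \<times> ?B)"
    unfolding mixed_monomials_def by (rule card_image_le) (use assms in \<open>auto simp: finite_PiE\<close>)
  also have "\<dots> = (e + 1) ^ m * card ?B" by (simp add: card_cartesian_product card_PiE)
  also have "\<dots> \<le> (e + 1) ^ m * (D + 1) ^ (card J - 1)" using B by simp
  finally show ?thesis .
qed

lemma mixed_mult:
  assumes "finite J" "f \<in> lincombs (mixed_monomials m e J D)" "g \<in> lincombs (mixed_monomials m e' J D')"
  shows "(\<lambda>y. f y * g y) \<in> lincombs (mixed_monomials m (e + e') J (D + D'))"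
proof (rule lincombs_mult[OF finite_mixed_monomials[OF assms(1)] _ assms(2,3)])
  fix f g assume f: "f \<in> mixed_monomials m e J D" and g: "g \<in> mixed_monomials m e' J D'"
  obtain a b where ab: "\<And>i. i < m \<Longrightarrow> a i \<le> e" "sum b J = D"
    "f = (\<lambda>(t, c). (\<Prod>i<m. t i ^ a i) * (\<Prod>j\<in>J. c j ^ b j))"
    using mixed_monomialE[OF f] by blast
  obtain a' b' where ab': "\<And>i. i < m \<Longrightarrow> a' i \<le> e'" "sum b' J = D'"
    "g = (\<lambda>(t, c). (\<Prod>i<m. t i ^ a' i) * (\<Prod>j\<in>J. c j ^ b' j))"
    using mixed_monomialE[OF g] by blast
  have "(\<lambda>y. f y * g y) =
     (\<lambda>(t, c). (\<Prod>i<m. t i ^ (a i + a' i)) * (\<Prod>j\<in>J. c j ^ (b j + b' j)))"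
    by (auto simp: ab(3) ab'(3) power_add prod.distrib)
  also have "\<dots> \<in> mixed_monomials m (e + e') J (D + D')"
    by (intro mixed_monomialI assms add_mono ab(1) ab'(1)) (simp_all add: sum.distrib ab(2) ab'(2))
  finally show "(\<lambda>y. f y * g y) \<in> mixed_monomials m (e + e') J (D + D')" .
qed

lemma mixed_one: "finite J \<Longrightarrow> (\<lambda>_. 1) \<in> lincombs (mixed_monomials m 0 J 0)"
  using mixed_monomialI[of J m "\<lambda>_. 0" 0 "\<lambda>_. 0" 0]
  by (intro lincombs_base finite_mixed_monomials) (auto simp: split_def)

lemma mixed_coord:
  assumes "finite J" "j \<in> J"
  shows "(\<lambda>(t, c). c j) \<in> lincombs (mixed_monomials m 0 J 1)"
proof -
  have "(\<lambda>(t::nat \<Rightarrow> complex, c::'a \<Rightarrow> complex). c j) =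
     (\<lambda>(t, c). (\<Prod>i<m. t i ^ 0) * (\<Prod>i\<in>J. c i ^ (if i = j then 1 else 0)))"
    using assms by (auto simp: if_distrib prod.delta cong: if_cong)
  also have "\<dots> \<in> mixed_monomials m 0 J 1"
    using assms by (intro mixed_monomialI) (auto simp: sum.delta)
  finally show ?thesis using assms by (intro lincombs_base finite_mixed_monomials)
qed

lemma mixed_weaken:
  assumes "finite J" "f \<in> lincombs (mixed_monomials m e J D)" "e \<le> e'"
  shows "f \<in> lincombs (mixed_monomials m e' J D)"
  using lincombs_mono[OF finite_mixed_monomials[OF assms(1)] mixed_monomials_mono[OF assms(3)]]
    assms(2) by blast

lemma mixed_power:
  assumes "finite J" "f \<in> lincombs (mixed_monomials m e J D)"
  shows "(\<lambda>y. f y ^ n) \<in> lincombs (mixed_monomials m (e * n) J (D * n))"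
proof (induction n)
  case (Suc n)
  show ?case using mixed_mult[OF assms(1) assms(2) Suc.IH] by simp
qed (use mixed_one[OF assms(1)] in simp)

lemma mixed_prod:
  assumes "finite J" "finite A" "\<And>i. i \<in> A \<Longrightarrow> f i \<in> lincombs (mixed_monomials m (e i) J (D i))"
  shows "(\<lambda>y. \<Prod>i\<in>A. f i y) \<in> lincombs (mixed_monomials m (sum e A) J (sum D A))"
  using assms(2,3)
proof (induction A rule: finite_induct)
  case empty
  show ?case using mixed_one[OF assms(1)] by simp
next
  case (insert i A)
  have "f i \<in> lincombs (mixed_monomials m (e i) J (D i))" by (rule insert.prems) simp
  moreover have "(\<lambda>y. \<Prod>i\<in>A. f i y) \<in> lincombs (mixed_monomials m (sum e A) J (sum D A))"
    by (rule insert.IH) (rule insert.prems, simp)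
  ultimately show ?case using mixed_mult[OF assms(1)] insert.hyps by simp
qed

lemma polyf_mixed:
  assumes "f \<in> polyf m" "finite J"
  shows "\<exists>e. (\<lambda>(t, c::'j \<Rightarrow> complex). f t) \<in> lincombs (mixed_monomials m e J 0)"
  using assms(1)
proof induction
  case (const c)
  show ?case using lincombs_scale[OF mixed_one[OF assms(2)], of c] by (auto simp: split_def)
next
  case (var i)
  have "(\<lambda>(t::nat \<Rightarrow> complex, c::'j \<Rightarrow> complex). t i) =
     (\<lambda>(t, c). (\<Prod>k<m. t k ^ (if k = i then 1 else 0)) * (\<Prod>j\<in>J. c j ^ 0))"
    using var by (auto simp: if_distrib prod.delta cong: if_cong)
  also have "\<dots> \<in> mixed_monomials m 1 J 0"
    using assms by (intro mixed_monomialI) auto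
  finally show ?case using assms(2) by (blast intro: lincombs_base finite_mixed_monomials)
next
  case (add f g)
  then obtain e e' where "(\<lambda>(t, c::'j \<Rightarrow> complex). f t) \<in> lincombs (mixed_monomials m e J 0)"
    "(\<lambda>(t, c::'j \<Rightarrow> complex). g t) \<in> lincombs (mixed_monomials m e' J 0)" by blast
  then have "(\<lambda>(t, c::'j \<Rightarrow> complex). f t) \<in> lincombs (mixed_monomials m (max e e') J 0)"
    "(\<lambda>(t, c::'j \<Rightarrow> complex). g t) \<in> lincombs (mixed_monomials m (max e e') J 0)"
    by (auto elim: mixed_weaken[OF assms(2)])
  from lincombs_add[OF this] show ?case by (auto simp: split_def)
next
  case (mult f g)
  then obtain e e' where "(\<lambda>(t, c::'j \<Rightarrow> complex). f t) \<in> lincombs (mixed_monomials m e J 0)"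
    "(\<lambda>(t, c::'j \<Rightarrow> complex). g t) \<in> lincombs (mixed_monomials m e' J 0)" by blast
  from mixed_mult[OF assms(2) this] show ?case by (auto simp: split_def)
qed

lemma polyf_mixed_uniform:
  assumes "finite F" "F \<subseteq> polyf m" "finite J"
  shows "\<exists>e. \<forall>f\<in>F. (\<lambda>(t, c::'j \<Rightarrow> complex). f t) \<in> lincombs (mixed_monomials m e J 0)"
proof -
  have "\<forall>f\<in>F. \<exists>e. (\<lambda>(t, c::'j \<Rightarrow> complex). f t) \<in> lincombs (mixed_monomials m e J 0)"
    using polyf_mixed assms by blast
  then obtain e where e: "\<forall>f\<in>F. (\<lambda>(t, c::'j \<Rightarrow> complex). f t) \<in> lincombs (mixed_monomials m (e f) J 0)"
    by metis
  have "e f \<le> Max (e ` F)" if "f \<in> F" for f using assms that by simp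
  with e show ?thesis by (meson mixed_weaken[OF assms(3)])
qed

text \<open>A monomial of degree \<open>D\<close> in the \<open>\<delta> t * c j\<close> expands in
  mixed monomials of degree at most \<open>e * D\<close> in each parameter and degree
  \<open>D\<close> in \<open>c'\<close>. The denominator is harmless because it scales all monomials
  of degree \<open>D\<close> by the same nonzero \<open>\<delta> t ^ D\<close>.\<close>

lemma thin_parametrized:
  assumes "finite J" "finite J'" "\<delta> \<in> polyf m" "\<And>j l. j \<in> J \<Longrightarrow> l \<in> J' \<Longrightarrow> a j l \<in> polyf m"
    and "card J' + m + 1 \<le> card J"
  shows "thin J {c. \<exists>t c'. \<delta> t \<noteq> 0 \<and> (\<forall>j\<in>J. \<delta> t * c j = (\<Sum>l\<in>J'. a j l t * c' l))}"
proof -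
  define \<psi> where "\<psi> j = (\<lambda>(t, c'). \<Sum>l\<in>J'. a j l t * c' l)" for j
  define F where "F = insert \<delta> ((\<lambda>(j, l). a j l) ` (J \<times> J'))"
  have "finite F" "F \<subseteq> polyf m" using assms by (auto simp: F_def)
  then obtain e where e: "\<forall>f\<in>F. (\<lambda>(t, c'). f t) \<in> lincombs (mixed_monomials m e J' 0)"
    using polyf_mixed_uniform assms(2) by blast
  have \<psi>: "\<psi> j \<in> lincombs (mixed_monomials m e J' 1)" if "j \<in> J" for j
  proof -
    have "(\<lambda>y. (case y of (t, c') \<Rightarrow> a j l t) * (case y of (t, c') \<Rightarrow> c' l))
        \<in> lincombs (mixed_monomials m (e + 0) J' (0 + 1))" if "l \<in> J'" for l
      using that \<open>j \<in> J\<close> e by (intro mixed_mult assms mixed_coord) (auto simp: F_def)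
    then show ?thesis unfolding \<psi>_def split_def by (intro lincombs_sum) auto
  qed
  show ?thesis unfolding thin_def
  proof (intro exI[of _ "(e + 1) ^ m"] allI impI)
    fix D :: nat assume D: "D \<ge> 1"
    let ?Q = "mixed_monomials m (e * D) J' D"
    have finQ: "finite ?Q" using assms by (intro finite_mixed_monomials)
    have "\<forall>p\<in>exponents J D. \<exists>M. \<forall>y.
      (\<Prod>j\<in>J. \<psi> j y ^ Poly_Mapping.lookup p j) = (\<Sum>q\<in>?Q. M q * q y)"
    proof
      fix p assume that: "p \<in> exponents J D"
      have "(\<lambda>y. \<Prod>j\<in>J. \<psi> j y ^ Poly_Mapping.lookup p j) \<in>
        lincombs (mixed_monomials m (\<Sum>j\<in>J. e * Poly_Mapping.lookup p j) J'
          (\<Sum>j\<in>J. 1 * Poly_Mapping.lookup p j))"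
        by (intro mixed_prod mixed_power assms \<psi>)
      moreover have "(\<Sum>j\<in>J. e * Poly_Mapping.lookup p j) = e * D"
        using that by (simp add: exponents_def flip: sum_distrib_left)
      moreover have "(\<Sum>j\<in>J. 1 * Poly_Mapping.lookup p j) = D"
        using that by (simp add: exponents_def)
      ultimately show "\<exists>M. \<forall>y.
        (\<Prod>j\<in>J. \<psi> j y ^ Poly_Mapping.lookup p j) = (\<Sum>q\<in>?Q. M q * q y)"
        by (simp add: lincombs_def)
    qed
    from bchoice[OF this] obtain M where M: "\<forall>p\<in>exponents J D. \<forall>y.
        (\<Prod>j\<in>J. \<psi> j y ^ Poly_Mapping.lookup p j) = (\<Sum>q\<in>?Q. M p q * q y)" ..
    \<comment> \<open>One vector for each mixed monomial \<open>q\<close>, listing its coefficients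
      in the expansions of all monomials \<open>p\<close>.\<close>
    define \<Lambda> where "\<Lambda> = (\<lambda>q p. M p q) ` ?Q"
    have fin: "finite \<Lambda>" using finQ by (simp add: \<Lambda>_def)
    have "card \<Lambda> * (D + 1)\<^sup>2 \<le> (e + 1) ^ m * (D + 1) ^ card J"
    \<comment> \<open>For empty \<open>J'\<close> the subtraction in \<open>card J' - 1\<close>
      truncates and the count would be off by one; there \<open>D \<ge> 1\<close> leaves no mixed
      monomials at all.\<close>
    proof (cases "J' = {}")
      case True
      then show ?thesis using D by (simp add: \<Lambda>_def mixed_monomials_empty)
    next
      case False
      have "card \<Lambda> \<le> card ?Q" unfolding \<Lambda>_def by (rule card_image_le[OF finQ])
      also have "\<dots> \<le> (e * D + 1) ^ m * (D + 1) ^ (card J' - 1)"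
        by (rule card_mixed_monomials[OF assms(2) False])
      also have "\<dots> \<le> ((e + 1) * (D + 1)) ^ m * (D + 1) ^ (card J' - 1)"
        by (intro mult_right_mono power_mono) auto
      finally have "card \<Lambda> * (D + 1)\<^sup>2 \<le> ((e + 1) * (D + 1)) ^ m * (D + 1) ^ (card J' - 1) * (D + 1)\<^sup>2"
        by (rule mult_right_mono) simp
      also have "\<dots> = (e + 1) ^ m * (D + 1) ^ (m + (card J' - 1) + 2)"
        by (simp only: power_mult_distrib power_add mult.assoc)
      also have "\<dots> \<le> (e + 1) ^ m * (D + 1) ^ card J"
      proof (intro mult_left_mono power_increasing)
        have "card J' \<noteq> 0" using False assms by simp
        then show "m + (card J' - 1) + 2 \<le> card J" using assms(5) by linarith
      qed auto
      finally show ?thesis .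
    qed
    moreover have "\<exists>h. \<forall>p\<in>exponents J D.
        (\<Prod>j\<in>J. c j ^ Poly_Mapping.lookup p j) = (\<Sum>v\<in>\<Lambda>. h v * v p)"
      if c: "\<delta> t \<noteq> 0" "\<forall>j\<in>J. \<delta> t * c j = (\<Sum>l\<in>J'. a j l t * c' l)" for c t c'
    proof (intro exI ballI)
      fix p assume p: "p \<in> exponents J D"
      \<comment> \<open>Several \<open>q\<close> may give the same vector \<open>v\<close>, so the
        coefficient of \<open>v\<close> sums over the whole fibre.\<close>
      let ?h = "\<lambda>v. (\<Sum>q | q \<in> ?Q \<and> (\<lambda>p. M p q) = v. q (t, c')) / \<delta> t ^ D"
      have "(\<Prod>j\<in>J. c j ^ Poly_Mapping.lookup p j) * \<delta> t ^ D =
          (\<Prod>j\<in>J. (\<delta> t * c j) ^ Poly_Mapping.lookup p j)"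
        using p by (simp add: exponents_def power_mult_distrib prod.distrib power_sum flip: power_sum)
      also have "\<dots> = (\<Sum>q\<in>?Q. M p q * q (t, c'))"
        using bspec[OF M p, rule_format, of "(t, c')"] c(2) by (simp add: \<psi>_def)
      also have "\<dots> = (\<Sum>v\<in>\<Lambda>. \<Sum>q | q \<in> ?Q \<and> (\<lambda>p. M p q) = v. M p q * q (t, c'))"
        unfolding \<Lambda>_def by (rule sum.image_gen[OF finQ])
      also have "\<dots> = (\<Sum>v\<in>\<Lambda>. (\<Sum>q | q \<in> ?Q \<and> (\<lambda>p. M p q) = v. q (t, c')) * v p)"
        by (intro sum.cong refl, subst sum_distrib_right, intro sum.cong refl) auto
      finally show "(\<Prod>j\<in>J. c j ^ Poly_Mapping.lookup p j) = (\<Sum>v\<in>\<Lambda>. ?h v * v p)"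
        using c(1) by (simp add: field_simps flip: sum_divide_distrib)
    qed
    ultimately show "\<exists>\<Lambda>. finite \<Lambda> \<and> card \<Lambda> * (D + 1)\<^sup>2 \<le> (e + 1) ^ m * (D + 1) ^ card J \<and>
     (\<forall>c\<in>{c. \<exists>t c'. \<delta> t \<noteq> 0 \<and> (\<forall>j\<in>J. \<delta> t * c j = (\<Sum>l\<in>J'. a j l t * c' l))}.
        \<exists>h. \<forall>p\<in>exponents J D. (\<Prod>j\<in>J. c j ^ Poly_Mapping.lookup p j) = (\<Sum>v\<in>\<Lambda>. h v * v p))"
      using fin by (intro exI[of _ \<Lambda>]) auto
  qed
qed

text \<open>One unknown \<open>c' k\<close> with \<open>\<phi> 0 k t \<noteq> 0\<close> is eliminated at a time, without dividing by
  \<open>\<phi> 0 k t\<close>, so that all coefficients remain polynomial in \<open>t\<close>.\<close>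

lemma thin_elimination:
  assumes "finite J" "finite J'" "\<delta> \<in> polyf m" "\<And>j l. j \<in> J \<Longrightarrow> l \<in> J' \<Longrightarrow> a j l \<in> polyf m"
    and "\<And>i l. i < r \<Longrightarrow> l \<in> J' \<Longrightarrow> \<phi> i l \<in> polyf m"
    and "card J' + m + 1 \<le> card J + r"
  shows "thin J {c. \<exists>t c'. \<delta> t \<noteq> 0 \<and> (\<forall>j\<in>J. \<delta> t * c j = (\<Sum>l\<in>J'. a j l t * c' l)) \<and>
    (\<forall>\<mu>. (\<forall>l\<in>J'. (\<Sum>i<r. \<mu> i * \<phi> i l t) = 0) \<longrightarrow> (\<forall>i<r. \<mu> i = 0)) \<and>
    (\<forall>i<r. (\<Sum>l\<in>J'. \<phi> i l t * c' l) = 0)}"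
  using assms(2-)
proof (induction r arbitrary: J' \<delta> a \<phi>)
  case 0
  then show ?case using thin_parametrized[OF assms(1) 0(1-3)] by simp
next
  case (Suc r)
  define B where "B = {c. \<exists>t c'. \<delta> t \<noteq> 0 \<and> (\<forall>j\<in>J. \<delta> t * c j = (\<Sum>l\<in>J'. a j l t * c' l)) \<and>
    (\<forall>\<mu>. (\<forall>l\<in>J'. (\<Sum>i<Suc r. \<mu> i * \<phi> i l t) = 0) \<longrightarrow> (\<forall>i<Suc r. \<mu> i = 0)) \<and>
    (\<forall>i<Suc r. (\<Sum>l\<in>J'. \<phi> i l t * c' l) = 0)}"
  define \<delta>' where "\<delta>' k = (\<lambda>t. \<delta> t * \<phi> 0 k t)" for k
  define a' where "a' k j l = (\<lambda>t. a j l t * \<phi> 0 k t - a j k t * \<phi> 0 l t)" for k j l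
  define \<phi>' where "\<phi>' k i l = (\<lambda>t. \<phi> (Suc i) l t * \<phi> 0 k t - \<phi> (Suc i) k t * \<phi> 0 l t)" for k i l
  define C where "C k = {c. \<exists>t c'. \<delta>' k t \<noteq> 0 \<and>
    (\<forall>j\<in>J. \<delta>' k t * c j = (\<Sum>l\<in>J' - {k}. a' k j l t * c' l)) \<and>
    (\<forall>\<mu>. (\<forall>l\<in>J' - {k}. (\<Sum>i<r. \<mu> i * \<phi>' k i l t) = 0) \<longrightarrow> (\<forall>i<r. \<mu> i = 0)) \<and>
    (\<forall>i<r. (\<Sum>l\<in>J' - {k}. \<phi>' k i l t * c' l) = 0)}" for k
  have thinC: "thin J (C k)" if k: "k \<in> J'" for k
    unfolding C_def
  proof (rule Suc.IH)
    show "card (J' - {k}) + m + 1 \<le> card J + r"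
      using k Suc.prems(1,5) card_Diff_singleton[OF k] by (cases "card J'") auto
  qed (use k Suc.prems in \<open>auto simp: \<delta>'_def a'_def \<phi>'_def intro!: polyf_diff polyf.mult\<close>)
  \<comment> \<open>The position of a nonzero entry in row 0 varies with \<open>t\<close>, which is
    why a union over all possible pivots \<open>k\<close> appears. A pivot exists because a zero row
    would be a linear relation.\<close>
  have "B \<subseteq> (\<Union>k\<in>J'. C k)"
  proof
    fix c assume "c \<in> B"
    then obtain t c' where \<delta>: "\<delta> t \<noteq> 0" and c: "\<And>j. j \<in> J \<Longrightarrow> \<delta> t * c j = (\<Sum>l\<in>J'. a j l t * c' l)"
      and ind: "\<And>\<mu>. (\<forall>l\<in>J'. (\<Sum>i<Suc r. \<mu> i * \<phi> i l t) = 0) \<Longrightarrow> (\<forall>i<Suc r. \<mu> i = 0)"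
      and ker: "\<And>i. i < Suc r \<Longrightarrow> (\<Sum>l\<in>J'. \<phi> i l t * c' l) = 0"
      unfolding B_def by blast
    have "\<exists>k\<in>J'. \<phi> 0 k t \<noteq> 0"
    proof (rule ccontr)
      assume "\<not> ?thesis"
      then have "\<forall>l\<in>J'. (\<Sum>i<Suc r. (if i = 0 then 1 else 0) * \<phi> i l t) = 0"
        by (simp add: sum.lessThan_Suc_shift del: sum.lessThan_Suc)
      from ind[OF this] show False by auto
    qed
    then obtain k where k: "k \<in> J'" "\<phi> 0 k t \<noteq> 0" by blast
    have elim: "(\<Sum>l\<in>J' - {k}. (f l * \<phi> 0 k t - f k * \<phi> 0 l t) * c' l) = \<phi> 0 k t * (\<Sum>l\<in>J'. f l * c' l)"
      for f
    proof -
      have "(\<Sum>l\<in>J'. \<phi> 0 l t * c' l) = 0" using ker[of 0] by simp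
      moreover have "(\<Sum>l\<in>J' - {k}. (f l * \<phi> 0 k t - f k * \<phi> 0 l t) * c' l) =
         (\<Sum>l\<in>J'. (f l * \<phi> 0 k t - f k * \<phi> 0 l t) * c' l)"
        using k Suc.prems(1) by (simp add: sum.remove[of J' k])
      moreover have "\<dots> = \<phi> 0 k t * (\<Sum>l\<in>J'. f l * c' l) - f k * (\<Sum>l\<in>J'. \<phi> 0 l t * c' l)"
        by (simp add: algebra_simps sum_subtractf sum_distrib_left)
      ultimately show ?thesis by simp
    qed
    have 1: "\<delta>' k t * c j = (\<Sum>l\<in>J' - {k}. a' k j l t * c' l)" if "j \<in> J" for j
      using elim[of "\<lambda>l. a j l t"] c[OF that] by (simp add: \<delta>'_def a'_def mult_ac)
    have 2: "(\<Sum>l\<in>J' - {k}. \<phi>' k i l t * c' l) = 0" if "i < r" for i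
      using elim[of "\<lambda>l. \<phi> (Suc i) l t"] ker[of "Suc i"] that by (simp add: \<phi>'_def)
    have 3: "\<forall>i<r. \<mu> i = 0" if \<mu>: "\<forall>l\<in>J' - {k}. (\<Sum>i<r. \<mu> i * \<phi>' k i l t) = 0" for \<mu>
    proof -
      define s where "s = (\<Sum>i<r. \<mu> i * \<phi> (Suc i) k t)"
      \<comment> \<open>Lifts a relation between the reduced rows to the original rows;
        \<open>- s\<close> on row 0 accounts for the multiples of that row subtracted in the
        elimination.\<close>
      define \<nu> where "\<nu> i = (case i of 0 \<Rightarrow> - s | Suc i \<Rightarrow> \<mu> i * \<phi> 0 k t)" for i
      have "(\<Sum>i<Suc r. \<nu> i * \<phi> i l t) = (\<Sum>i<r. \<mu> i * \<phi>' k i l t)" for l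
        by (simp add: sum.lessThan_Suc_shift \<nu>_def s_def \<phi>'_def algebra_simps sum_subtractf
            sum_distrib_left del: sum.lessThan_Suc)
      moreover have "(\<Sum>i<r. \<mu> i * \<phi>' k i k t) = 0" by (simp add: \<phi>'_def)
      ultimately have "\<forall>l\<in>J'. (\<Sum>i<Suc r. \<nu> i * \<phi> i l t) = 0" using \<mu> by (metis DiffI singletonD)
      from ind[OF this] have "\<nu> (Suc i) = 0" if "i < r" for i using that by blast
      then show ?thesis using k by (simp add: \<nu>_def)
    qed
    show "c \<in> (\<Union>k\<in>J'. C k)"
      unfolding C_def using k \<delta> 1 2 3
      by (intro UN_I[OF k(1)] CollectI exI[of _ t] exI[of _ c']) (auto simp: \<delta>'_def)
  qed
  then show ?case
    using thin_subset[OF thin_UN[OF Suc.prems(1), of J C]] thinC unfolding B_def by blast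
qed

text \<open>Elimination starts from the trivial parametrization \<open>c = c'\<close> with
  \<open>\<delta> = 1\<close> and \<open>J' = J\<close>, for which its inequality reads
  \<open>m < r\<close>.\<close>

lemma thin_kernels:
  assumes "finite J" "\<And>i l. i < r \<Longrightarrow> l \<in> J \<Longrightarrow> \<phi> i l \<in> polyf m" "m < r"
  shows "thin J {c. \<exists>t.
    (\<forall>\<mu>. (\<forall>l\<in>J. (\<Sum>i<r. \<mu> i * \<phi> i l t) = 0) \<longrightarrow> (\<forall>i<r. \<mu> i = 0)) \<and>
    (\<forall>i<r. (\<Sum>l\<in>J. \<phi> i l t * c l) = 0)}"
proof (rule thin_subset[OF thin_elimination[of J J "\<lambda>_. 1" m "\<lambda>j l _. if j = l then 1 else 0" r \<phi>]])
qed (use assms in \<open>auto intro: polyf.const simp: if_distrib if_distribR sum.delta cong: if_cong\<close>)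

section \<open>Forms and their directional derivatives\<close>

definition mono_eval :: "('i \<Rightarrow> complex) \<Rightarrow> ('i \<Rightarrow>\<^sub>0 nat) \<Rightarrow> complex" where
  "mono_eval x m = (\<Prod>i\<in>Poly_Mapping.keys m. x i ^ Poly_Mapping.lookup m i)"

lemma mono_eval_superset:
  "finite S \<Longrightarrow> Poly_Mapping.keys m \<subseteq> S \<Longrightarrow> mono_eval x m = (\<Prod>i\<in>S. x i ^ Poly_Mapping.lookup m i)"
  unfolding mono_eval_def by (rule prod.mono_neutral_left) (auto simp: in_keys_iff)

lemma mono_eval_add: "mono_eval x (m + n) = mono_eval x m * mono_eval x n"
proof -
  let ?S = "Poly_Mapping.keys m \<union> Poly_Mapping.keys n"
  have "mono_eval x (m + n) = (\<Prod>i\<in>?S. x i ^ Poly_Mapping.lookup (m + n) i)"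
    by (rule mono_eval_superset) (use keys_add[of m n] in auto)
  also have "\<dots> = (\<Prod>i\<in>?S. x i ^ Poly_Mapping.lookup m i) * (\<Prod>i\<in>?S. x i ^ Poly_Mapping.lookup n i)"
    by (simp add: lookup_add power_add prod.distrib)
  also have "\<dots> = mono_eval x m * mono_eval x n"
    by (simp add: mono_eval_superset[of ?S])
  finally show ?thesis .
qed

lemma eval_cpoly_superset:
  "finite S \<Longrightarrow> Poly_Mapping.keys F \<subseteq> S \<Longrightarrow>
    eval_cpoly x F = (\<Sum>m\<in>S. Poly_Mapping.lookup F m * mono_eval x m)"
  unfolding eval_cpoly_def mono_eval_def[symmetric]
  by (rule sum.mono_neutral_left) (auto simp: in_keys_iff)

lemma eval_cpoly_add: "eval_cpoly x (F + G) = eval_cpoly x F + eval_cpoly x G"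
proof -
  let ?S = "Poly_Mapping.keys F \<union> Poly_Mapping.keys G"
  have "eval_cpoly x (F + G) = (\<Sum>m\<in>?S. Poly_Mapping.lookup (F + G) m * mono_eval x m)"
    by (rule eval_cpoly_superset) (use keys_add[of F G] in auto)
  then show ?thesis
    by (simp add: eval_cpoly_superset[of ?S] lookup_add distrib_right sum.distrib)
qed

lemma eval_cpoly_zero [simp]: "eval_cpoly x 0 = 0"
  by (simp add: eval_cpoly_def)

lemma eval_cpoly_single: "eval_cpoly x (Poly_Mapping.single m c) = c * mono_eval x m"
  by (simp add: eval_cpoly_superset[of "{m}"])

lemma eval_cpoly_sum: "eval_cpoly x (\<Sum>a\<in>A. F a) = (\<Sum>a\<in>A. eval_cpoly x (F a))"
  by (induction A rule: infinite_finite_induct) (simp_all add: eval_cpoly_add)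

lemma poly_mapping_sum_single:
  "F = (\<Sum>m\<in>Poly_Mapping.keys F. Poly_Mapping.single m (Poly_Mapping.lookup F m))"
  by (rule poly_mapping_eqI) (simp add: lookup_sum lookup_single when_def in_keys_iff sum.delta)

lemma eval_cpoly_mult: "eval_cpoly x (F * G) = eval_cpoly x F * eval_cpoly x G"
proof -
  have "F * G = (\<Sum>m\<in>Poly_Mapping.keys F. \<Sum>n\<in>Poly_Mapping.keys G.
      Poly_Mapping.single (m + n) (Poly_Mapping.lookup F m * Poly_Mapping.lookup G n))"
    by (subst poly_mapping_sum_single[of F], subst poly_mapping_sum_single[of G])
      (simp add: sum_product mult_single)
  then show ?thesis
    by (simp add: eval_cpoly_sum eval_cpoly_single mono_eval_add
        eval_cpoly_def[of x F] eval_cpoly_def[of x G] sum_product mult_ac flip: mono_eval_def)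
qed

lemma eval_cpoly_one: "eval_cpoly x 1 = 1"
  by (simp add: eval_cpoly_single mono_eval_def flip: single_one)

lemma eval_cpoly_prod: "eval_cpoly x (\<Prod>a\<in>A. F a) = (\<Prod>a\<in>A. eval_cpoly x (F a))"
  by (induction A rule: infinite_finite_induct) (simp_all add: eval_cpoly_mult eval_cpoly_one)

lemma lookup_fs_scale: "Poly_Mapping.lookup (fs_scale c F) m = c * Poly_Mapping.lookup F m"
  by (simp add: fs_scale_def map.rep_eq when_def)

lemma eval_cpoly_fs_scale: "eval_cpoly x (fs_scale c F) = c * eval_cpoly x F"
proof -
  have "Poly_Mapping.keys (fs_scale c F) \<subseteq> Poly_Mapping.keys F"
    by (auto simp: in_keys_iff lookup_fs_scale)
  then show ?thesis
    by (simp add: eval_cpoly_superset[of "Poly_Mapping.keys F"] lookup_fs_scale sum_distrib_left mult.assoc)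
qed

lemma homogeneous_zero: "homogeneous n 0"
  by (simp add: homogeneous_def)

lemma homogeneous_add: "homogeneous n F \<Longrightarrow> homogeneous n G \<Longrightarrow> homogeneous n (F + G)"
  unfolding homogeneous_def using keys_add[of F G] by blast

lemma homogeneous_sum: "(\<And>a. a \<in> A \<Longrightarrow> homogeneous n (F a)) \<Longrightarrow> homogeneous n (\<Sum>a\<in>A. F a)"
  by (induction A rule: infinite_finite_induct) (auto intro: homogeneous_zero homogeneous_add)

lemma homogeneous_fs_scale: "homogeneous n F \<Longrightarrow> homogeneous n (fs_scale c F)"
  by (auto simp: homogeneous_def in_keys_iff lookup_fs_scale)

lemma exponent_sum_superset:
  "finite S \<Longrightarrow> Poly_Mapping.keys m \<subseteq> S \<Longrightarrow>
    (\<Sum>i\<in>Poly_Mapping.keys m. Poly_Mapping.lookup m i) = (\<Sum>i\<in>S. Poly_Mapping.lookup m i :: nat)"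
  by (rule sum.mono_neutral_left) (auto simp: in_keys_iff)

lemma homogeneous_mult:
  assumes "homogeneous n F" "homogeneous k G" shows "homogeneous (n + k) (F * G)"
  unfolding homogeneous_def
proof
  fix m assume "m \<in> Poly_Mapping.keys (F * G)"
  then obtain a b where ab: "m = a + b" "a \<in> Poly_Mapping.keys F" "b \<in> Poly_Mapping.keys G"
    using keys_mult[of F G] by blast
  let ?S = "Poly_Mapping.keys a \<union> Poly_Mapping.keys b"
  have "(\<Sum>i\<in>Poly_Mapping.keys m. Poly_Mapping.lookup m i) = (\<Sum>i\<in>?S. Poly_Mapping.lookup m i)"
    unfolding ab by (rule exponent_sum_superset) (use keys_add[of a b] in auto)
  also have "\<dots> = (\<Sum>i\<in>?S. Poly_Mapping.lookup a i) + (\<Sum>i\<in>?S. Poly_Mapping.lookup b i)"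
    by (simp add: ab lookup_add sum.distrib)
  also have "\<dots> = n + k"
    using assms ab(2,3) exponent_sum_superset[of ?S a] exponent_sum_superset[of ?S b]
    by (simp add: homogeneous_def)
  finally show "(\<Sum>i\<in>Poly_Mapping.keys m. Poly_Mapping.lookup m i) = n + k" .
qed

lemma homogeneous_prod:
  "finite A \<Longrightarrow> (\<And>a. a \<in> A \<Longrightarrow> homogeneous 1 (F a)) \<Longrightarrow> homogeneous (card A) (\<Prod>a\<in>A. F a)"
proof (induction A rule: finite_induct)
  case empty then show ?case by (simp add: homogeneous_def)
next
  case (insert a A)
  then have "homogeneous (1 + card A) (F a * (\<Prod>a\<in>A. F a))" by (intro homogeneous_mult) auto
  then show ?case using insert.hyps by simp
qed

lemma eval_cpoly_homogeneous:
  assumes "homogeneous n F" shows "eval_cpoly (\<lambda>i. c * x i) F = c ^ n * eval_cpoly x F"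
proof -
  have "mono_eval (\<lambda>i. c * x i) m = c ^ n * mono_eval x m" if "m \<in> Poly_Mapping.keys F" for m
  proof -
    have "(\<Prod>i\<in>Poly_Mapping.keys m. c ^ Poly_Mapping.lookup m i) = c ^ n"
      using assms that unfolding homogeneous_def by (simp flip: power_sum)
    then show ?thesis by (simp add: mono_eval_def power_mult_distrib prod.distrib)
  qed
  then show ?thesis
    by (simp add: eval_cpoly_def sum_distrib_left mult_ac flip: mono_eval_def)
qed

text \<open>Finite-dimensionality of the space of forms of degree \<open>n\<close>, in the shape
  that \<open>echelon_basis\<close> requires: every exponent is at most \<open>n\<close>.\<close>

lemma finite_homogeneous_support: "finite (\<Union>F\<in>{F::('i::finite) cpoly. homogeneous n F}. Poly_Mapping.keys F)"
proof (rule finite_subset)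
  let ?X = "PiE UNIV (\<lambda>_::'i. {..n})"
  show "(\<Union>F\<in>{F::'i cpoly. homogeneous n F}. Poly_Mapping.keys F) \<subseteq> Poly_Mapping.Abs_poly_mapping ` ?X"
  proof safe
    fix F :: "'i cpoly" and m assume F: "homogeneous n F" "m \<in> Poly_Mapping.keys F"
    have "Poly_Mapping.lookup m i \<le> n" for i
    proof -
      have "Poly_Mapping.lookup m i \<le> (\<Sum>i\<in>UNIV. Poly_Mapping.lookup m i)"
        by (rule member_le_sum) auto
      also have "\<dots> = n" using F exponent_sum_superset[of UNIV m] by (simp add: homogeneous_def)
      finally show ?thesis .
    qed
    then have "Poly_Mapping.lookup m \<in> ?X" by auto
    then show "m \<in> Poly_Mapping.Abs_poly_mapping ` ?X"
      by (metis image_eqI lookup_inverse)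
  qed
qed (simp add: finite_PiE)

section \<open>Directional derivatives\<close>

definition dir_deriv :: "'i::finite cpoly \<Rightarrow> complex ^ 'i \<Rightarrow> complex ^ 'i \<Rightarrow> complex" where
  "dir_deriv F x l = (\<Sum>i\<in>UNIV. l $ i * eval_cpoly (($) x) (partial_cpoly i F))"

text \<open>Identifies the formal partial derivatives with an analytic derivative, so that
  linearity, scaling, Euler's identity and the Leibniz rule follow from uniqueness of
  derivatives.\<close>

lemma has_field_derivative_dir_deriv:
  "((\<lambda>s. eval_cpoly (($) (x + s *s l)) F) has_field_derivative dir_deriv F x l) (at 0)"
proof -
  have part: "eval_cpoly (($) x) (partial_cpoly i F) = (\<Sum>m\<in>Poly_Mapping.keys F.
     Poly_Mapping.lookup F m * (of_nat (Poly_Mapping.lookup m i) * x $ i ^ (Poly_Mapping.lookup m i - 1)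
      * (\<Prod>k\<in>UNIV - {i}. x $ k ^ Poly_Mapping.lookup m k)))" for i
  proof -
    have "mono_eval (($) x) (m - Poly_Mapping.single i 1) =
      x $ i ^ (Poly_Mapping.lookup m i - 1) * (\<Prod>k\<in>UNIV - {i}. x $ k ^ Poly_Mapping.lookup m k)" for m
    proof -
      have "(\<Prod>k\<in>UNIV - {i}. x $ k ^ Poly_Mapping.lookup (m - Poly_Mapping.single i 1) k) =
        (\<Prod>k\<in>UNIV - {i}. x $ k ^ Poly_Mapping.lookup m k)"
        by (rule prod.cong) (auto simp: lookup_minus lookup_single)
      then show ?thesis
        by (simp add: mono_eval_superset[of UNIV] prod.remove[of UNIV i] lookup_minus)
    qed
    then show ?thesis
      by (simp add: partial_cpoly_def eval_cpoly_sum eval_cpoly_single mult_ac)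
  qed
  have "((\<lambda>s. \<Sum>m\<in>Poly_Mapping.keys F. Poly_Mapping.lookup F m *
      (\<Prod>i\<in>UNIV. (x $ i + s * l $ i) ^ Poly_Mapping.lookup m i)) has_field_derivative
    (\<Sum>m\<in>Poly_Mapping.keys F. Poly_Mapping.lookup F m *
      (\<Sum>i\<in>UNIV. (of_nat (Poly_Mapping.lookup m i) * (x $ i + 0 * l $ i) ^ (Poly_Mapping.lookup m i - 1) * l $ i)
      * (\<Prod>k\<in>UNIV - {i}. (x $ k + 0 * l $ k) ^ Poly_Mapping.lookup m k)))) (at 0)"
    by (intro DERIV_sum DERIV_cmult has_field_derivative_prod) (auto intro!: derivative_eq_intros)
  moreover have "(\<Sum>m\<in>Poly_Mapping.keys F. Poly_Mapping.lookup F m *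
      (\<Sum>i\<in>UNIV. (of_nat (Poly_Mapping.lookup m i) * (x $ i + 0 * l $ i) ^ (Poly_Mapping.lookup m i - 1) * l $ i)
      * (\<Prod>k\<in>UNIV - {i}. (x $ k + 0 * l $ k) ^ Poly_Mapping.lookup m k))) = dir_deriv F x l"
    unfolding dir_deriv_def part sum_distrib_left by (subst sum.swap) (simp add: mult_ac)
  moreover have "eval_cpoly (($) (x + s *s l)) F = (\<Sum>m\<in>Poly_Mapping.keys F. Poly_Mapping.lookup F m *
      (\<Prod>i\<in>UNIV. (x $ i + s * l $ i) ^ Poly_Mapping.lookup m i))" for s
    by (simp add: eval_cpoly_superset[of "Poly_Mapping.keys F"] mono_eval_superset[of UNIV])
  ultimately show ?thesis by simp
qed

lemma dir_deriv_unique: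
  "((\<lambda>s. eval_cpoly (($) (x + s *s l)) F) has_field_derivative D) (at 0) \<Longrightarrow> dir_deriv F x l = D"
  by (rule DERIV_unique[OF has_field_derivative_dir_deriv])

lemma dir_deriv_lincomb:
  "dir_deriv (\<Sum>j\<in>J. fs_scale (c j) (b j)) x l = (\<Sum>j\<in>J. c j * dir_deriv (b j) x l)"
proof (rule dir_deriv_unique)
  show "((\<lambda>s. eval_cpoly (($) (x + s *s l)) (\<Sum>j\<in>J. fs_scale (c j) (b j))) has_field_derivative
     (\<Sum>j\<in>J. c j * dir_deriv (b j) x l)) (at 0)"
    unfolding eval_cpoly_sum eval_cpoly_fs_scale
    by (intro DERIV_sum DERIV_cmult has_field_derivative_dir_deriv)
qed

text \<open>Scaling point and direction together gives the factor \<open>c ^ n\<close> and avoids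
  the truncated exponent \<open>n - 1\<close>.\<close>

lemma dir_deriv_scale_arg:
  assumes "homogeneous n F" shows "dir_deriv F (c *s x) (c *s l) = c ^ n * dir_deriv F x l"
proof (rule dir_deriv_unique)
  have "($) (c *s x + s *s (c *s l)) = (\<lambda>i. c * (x + s *s l) $ i)" for s
    by (auto simp: algebra_simps)
  then have "eval_cpoly (($) (c *s x + s *s (c *s l))) F = c ^ n * eval_cpoly (($) (x + s *s l)) F" for s
    by (simp only: eval_cpoly_homogeneous[OF assms])
  then show "((\<lambda>s. eval_cpoly (($) (c *s x + s *s (c *s l))) F) has_field_derivative
     c ^ n * dir_deriv F x l) (at 0)"
    by (simp only:) (intro DERIV_cmult has_field_derivative_dir_deriv)
qed

text \<open>Obtained by differentiating \<open>(1 + s) ^ n\<close> at \<open>s = 0\<close>. It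
  expresses vanishing at \<open>x\<close> as a condition on the derivative in the direction
  \<open>x\<close>.\<close>

lemma dir_deriv_euler:
  assumes "homogeneous n F" shows "dir_deriv F x x = of_nat n * eval_cpoly (($) x) F"
proof (rule dir_deriv_unique)
  have "($) (x + s *s x) = (\<lambda>i. (1 + s) * x $ i)" for s
    by (auto simp: algebra_simps)
  then have "eval_cpoly (($) (x + s *s x)) F = (1 + s) ^ n * eval_cpoly (($) x) F" for s
    by (simp only: eval_cpoly_homogeneous[OF assms])
  then show "((\<lambda>s. eval_cpoly (($) (x + s *s x)) F) has_field_derivative
     of_nat n * eval_cpoly (($) x) F) (at 0)"
    by (simp only:) (auto intro!: derivative_eq_intros)
qed

lemma dir_deriv_combine:
  "dir_deriv F x (\<Sum>i\<in>A. c i *s l i) = (\<Sum>i\<in>A. c i * dir_deriv F x (l i))"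
  unfolding dir_deriv_def sum_distrib_left sum_distrib_right
  by (subst sum.swap) (simp add: sum_distrib_right sum_distrib_left mult_ac)

definition form :: "complex ^ 4 \<Rightarrow> complex ^ 4 \<Rightarrow> complex" where
  "form a x = (\<Sum>i\<in>UNIV. a $ i * x $ i)"

definition linear_cpoly :: "complex ^ 4 \<Rightarrow> 4 cpoly" where
  "linear_cpoly a = (\<Sum>i\<in>UNIV. Poly_Mapping.single (Poly_Mapping.single i 1) (a $ i))"

lemma eval_linear_cpoly: "eval_cpoly (($) x) (linear_cpoly a) = form a x"
  by (simp add: linear_cpoly_def form_def eval_cpoly_sum eval_cpoly_single mono_eval_def)

lemma homogeneous_linear_cpoly: "homogeneous 1 (linear_cpoly a)"
  unfolding linear_cpoly_def by (intro homogeneous_sum) (simp add: homogeneous_def)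

lemma form_add: "form a (x + y) = form a x + form a y"
  by (simp add: form_def algebra_simps sum.distrib)

lemma form_scale: "form a (c *s x) = c * form a x"
  by (simp add: form_def algebra_simps sum_distrib_left)

text \<open>In the Leibniz sum every term except the one differentiating the factor \<open>s\<close>
  still contains that factor, which is zero at \<open>x\<close>.\<close>

lemma dir_deriv_prod_linear:
  assumes "finite S" "s \<in> S" "form (a s) x = 0"
  shows "dir_deriv (\<Prod>s\<in>S. linear_cpoly (a s)) x l = form (a s) l * (\<Prod>s\<in>S - {s}. form (a s) x)"
proof (rule dir_deriv_unique)
  have "((\<lambda>u. \<Prod>s\<in>S. form (a s) x + u * form (a s) l) has_field_derivative
     (\<Sum>s\<in>S. form (a s) l * (\<Prod>s'\<in>S - {s}. form (a s') x + 0 * form (a s') l))) (at 0)"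
    by (intro has_field_derivative_prod) (auto intro!: derivative_eq_intros)
  moreover have "(\<Sum>s\<in>S. form (a s) l * (\<Prod>s'\<in>S - {s}. form (a s') x + 0 * form (a s') l)) =
     form (a s) l * (\<Prod>s\<in>S - {s}. form (a s) x)"
  proof -
    have "(\<Prod>s''\<in>S - {s'}. form (a s'') x) = 0" if "s' \<in> S - {s}" for s'
      by (rule prod_zero) (use assms that in auto)
    then have "(\<Sum>s'\<in>S - {s}. form (a s') l * (\<Prod>s''\<in>S - {s'}. form (a s'') x + 0 * form (a s'') l)) = 0"
      by (intro sum.neutral) simp
    then show ?thesis unfolding sum.remove[OF assms(1,2)] by simp
  qed
  ultimately show "((\<lambda>u. eval_cpoly (($) (x + u *s l)) (\<Prod>s\<in>S. linear_cpoly (a s))) has_field_derivative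
    form (a s) l * (\<Prod>s\<in>S - {s}. form (a s) x)) (at 0)"
    by (simp add: eval_cpoly_prod eval_linear_cpoly form_add form_scale)
qed

text \<open>A reduced echelon form, so that coordinates on \<open>V\<close> are honest coefficients
  \<open>Poly_Mapping.lookup F j\<close>. A form in these coordinates is then directly a polynomial
  of the kind that defines Zariski open sets. \<open>J\<close> is a pivot set of maximal
  size.\<close>

lemma echelon_basis:
  fixes V :: "('j \<Rightarrow>\<^sub>0 complex) set"
  assumes fin: "finite (\<Union>F\<in>V. Poly_Mapping.keys F)"
    and add: "\<And>F G. F \<in> V \<Longrightarrow> G \<in> V \<Longrightarrow> F + G \<in> V"
    and scale: "\<And>c F. F \<in> V \<Longrightarrow> fs_scale c F \<in> V" and zero: "0 \<in> V"
  obtains J b where "finite J" "\<And>j. j \<in> J \<Longrightarrow> b j \<in> V"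
    "\<And>i j. i \<in> J \<Longrightarrow> j \<in> J \<Longrightarrow> Poly_Mapping.lookup (b j) i = (if i = j then 1 else 0)"
    "\<And>F. F \<in> V \<Longrightarrow> F = (\<Sum>j\<in>J. fs_scale (Poly_Mapping.lookup F j) (b j))"
proof -
  let ?K = "\<Union>F\<in>V. Poly_Mapping.keys F"
  let ?P = "\<lambda>J. J \<subseteq> ?K \<and> (\<exists>b. (\<forall>j\<in>J. b j \<in> V) \<and>
    (\<forall>i\<in>J. \<forall>j\<in>J. Poly_Mapping.lookup (b j) i = (if i = j then 1 else 0)))"
  have "\<exists>J. ?P J \<and> (\<forall>J'. ?P J' \<longrightarrow> card J' \<le> card J)"
  proof (rule ex_has_greatest_nat)
    show "?P {}" by simp
    show "\<forall>J. ?P J \<longrightarrow> card J < card ?K + 1" using fin by (auto intro: card_mono simp: less_Suc_eq_le)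
  qed
  then obtain J where J0: "?P J \<and> (\<forall>J'. ?P J' \<longrightarrow> card J' \<le> card J)" ..
  note max = J0[THEN conjunct2, rule_format]
  from J0[THEN conjunct1, THEN conjunct2] obtain b where b: "(\<forall>j\<in>J. b j \<in> V) \<and>
    (\<forall>i\<in>J. \<forall>j\<in>J. Poly_Mapping.lookup (b j) i = (if i = j then 1 else 0))" ..
  have J: "J \<subseteq> ?K" "\<And>j. j \<in> J \<Longrightarrow> b j \<in> V"
    "\<And>i j. i \<in> J \<Longrightarrow> j \<in> J \<Longrightarrow> Poly_Mapping.lookup (b j) i = (if i = j then 1 else 0)"
    using J0[THEN conjunct1, THEN conjunct1] b by auto
  have fJ: "finite J" using J(1) fin finite_subset by blast
  have vsum: "(\<Sum>j\<in>A. f j) \<in> V" if "\<And>j. j \<in> A \<Longrightarrow> f j \<in> V" for A and f :: "'j \<Rightarrow> 'j \<Rightarrow>\<^sub>0 complex"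
    using that by (induction A rule: infinite_finite_induct) (auto intro: zero add)
  \<comment> \<open>A nonzero \<open>F\<close> with zero entries on \<open>J\<close> would provide a
    new pivot \<open>i\<close>: normalize it there and clear the entry \<open>i\<close> of the other
    basis elements.\<close>
  have nz: "F = 0" if F: "F \<in> V" "\<forall>j\<in>J. Poly_Mapping.lookup F j = 0" for F
  proof (rule ccontr)
    assume "F \<noteq> 0"
    then obtain i where i: "Poly_Mapping.lookup F i \<noteq> 0" by (metis lookup_zero poly_mapping_eqI)
    then have iJ: "i \<notin> J" using F by auto
    define F' where "F' = fs_scale (1 / Poly_Mapping.lookup F i) F"
    define b' where "b' j = (if j = i then F' else b j + fs_scale (- Poly_Mapping.lookup (b j) i) F')" for j
    have F': "Poly_Mapping.lookup F' i = 1" "\<And>j. j \<in> J \<Longrightarrow> Poly_Mapping.lookup F' j = 0" "F' \<in> V"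
      using F i scale by (auto simp: F'_def lookup_fs_scale)
    have "?P (insert i J)"
    proof (intro conjI exI[of _ b'])
      show "insert i J \<subseteq> ?K" using J(1) F(1) i by (auto simp: in_keys_iff)
      show "\<forall>j\<in>insert i J. b' j \<in> V" using J F' by (auto simp: b'_def intro: add scale)
      show "\<forall>k\<in>insert i J. \<forall>j\<in>insert i J. Poly_Mapping.lookup (b' j) k = (if k = j then 1 else 0)"
        using J F' iJ by (auto simp: b'_def lookup_add lookup_fs_scale)
    qed
    from max[OF this] show False using iJ fJ by simp
  qed
  have expand: "F = (\<Sum>j\<in>J. fs_scale (Poly_Mapping.lookup F j) (b j))" if F: "F \<in> V" for F
  proof -
    define G where "G = F + fs_scale (-1) (\<Sum>j\<in>J. fs_scale (Poly_Mapping.lookup F j) (b j))"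
    have "G \<in> V" unfolding G_def by (intro add scale vsum F J)
    moreover have "\<forall>i\<in>J. Poly_Mapping.lookup G i = 0"
    proof
      fix i assume i: "i \<in> J"
      have "(\<Sum>j\<in>J. Poly_Mapping.lookup F j * Poly_Mapping.lookup (b j) i) =
        (\<Sum>j\<in>J. if j = i then Poly_Mapping.lookup F j else 0)"
        by (rule sum.cong) (use J(3) i in auto)
      then show "Poly_Mapping.lookup G i = 0"
        using i fJ by (simp add: G_def lookup_add lookup_fs_scale lookup_sum)
    qed
    ultimately have "G = 0" by (rule nz)
    then have "Poly_Mapping.lookup G m = 0" for m by simp
    then have "Poly_Mapping.lookup F m - Poly_Mapping.lookup (\<Sum>j\<in>J. fs_scale (Poly_Mapping.lookup F j) (b j)) m = 0" for m
      by (simp only: G_def lookup_add lookup_fs_scale diff_conv_add_uminus mult_minus1)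
    then have "Poly_Mapping.lookup F m = Poly_Mapping.lookup (\<Sum>j\<in>J. fs_scale (Poly_Mapping.lookup F j) (b j)) m" for m
      by (rule right_minus_eq[THEN iffD1])
    then show ?thesis by (rule poly_mapping_eqI)
  qed
  show ?thesis by (rule that[OF fJ J(2,3) expand])
qed

section \<open>Planes in four-dimensional space\<close>

text \<open>Extend a basis of \<open>U\<close> together with \<open>x\<close> to a basis of the
  whole space; \<open>a\<close> represents the coordinate functional belonging to
  \<open>x\<close>.\<close>

lemma separating_form:
  assumes "vec.subspace U" "x \<notin> U"
  shows "\<exists>a. (\<forall>u\<in>U. form a u = 0) \<and> form a x \<noteq> 0"
proof -
  obtain S where S: "S \<subseteq> U" "vec.independent S" "U \<subseteq> vec.span S"
    using vec.basis_exists by metis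
  then have span: "vec.span S = U"
    using assms(1) by (metis vec.span_minimal subset_antisym)
  with assms(2) S(2) have ind: "vec.independent (insert x S)"
    by (simp add: vec.independent_insert)
  define B where "B = vec.extend_basis (insert x S)"
  have B: "vec.independent B" "vec.span B = UNIV" "insert x S \<subseteq> B"
    unfolding B_def using ind vec.independent_extend_basis vec.span_extend_basis
      vec.extend_basis_superset by blast+
  define f where "f y = vec.representation B y x" for y
  define a where "a = (\<chi> i. f (axis i 1))"
  have "form a y = f y" for y
  proof -
    have "f y = f (\<Sum>i\<in>UNIV. (y $ i) *s axis i 1)" by (simp add: basis_expansion)
    also have "\<dots> = (\<Sum>i\<in>UNIV. y $ i * f (axis i 1))"
      using B by (simp add: f_def vec.representation_sum vec.representation_scale)
    finally show ?thesis by (simp add: form_def a_def mult.commute)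
  qed
  moreover have "f x = 1" using B by (simp add: f_def vec.representation_basis)
  moreover have "f u = 0" if "u \<in> U" for u
  proof -
    have "vec.representation B u = vec.representation S u"
      using B that span by (intro vec.representation_extend) auto
    moreover have "x \<notin> S" using assms(2) S by blast
    ultimately show ?thesis unfolding f_def by (metis vec.representation_ne_zero)
  qed
  ultimately show ?thesis by (intro exI[of _ a]) auto
qed

lemma dim2_basis:
  fixes W :: "(complex ^ 4) set"
  assumes "vec.subspace W" "vec.dim W = 2"
  obtains u v where "u \<in> W" "v \<in> W"
    "\<And>\<alpha> \<beta>. \<alpha> *s u + \<beta> *s v = 0 \<Longrightarrow> \<alpha> = 0 \<and> \<beta> = 0"
    "\<And>w. w \<in> W \<Longrightarrow> \<exists>\<alpha> \<beta>. w = \<alpha> *s u + \<beta> *s v"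
proof -
  obtain S where S: "S \<subseteq> W" "vec.independent S" "W \<subseteq> vec.span S" "card S = 2"
    using vec.basis_exists[of W] assms by metis
  then obtain u v where uv: "S = {u, v}" "u \<noteq> v" by (auto simp: card_2_iff)
  show ?thesis
  proof (rule that[of u v])
    show "u \<in> W" "v \<in> W" using S uv by auto
    show "\<alpha> = 0 \<and> \<beta> = 0" if "\<alpha> *s u + \<beta> *s v = 0" for \<alpha> \<beta>
    proof -
      have "(\<Sum>x\<in>S. (if x = u then \<alpha> else \<beta>) *s x) = 0" using uv that by simp
      moreover have "\<forall>c. (\<Sum>x\<in>S. c x *s x) = 0 \<longrightarrow> (\<forall>x\<in>S. c x = 0)"
        using S(2) unfolding vec.independent_explicit by (rule conjunct2)
      note this[rule_format, of "\<lambda>x. if x = u then \<alpha> else \<beta>"]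
      ultimately have "\<forall>x\<in>S. (if x = u then \<alpha> else \<beta>) = 0" by blast
      then show ?thesis using uv by auto
    qed
    show "\<exists>\<alpha> \<beta>. w = \<alpha> *s u + \<beta> *s v" if "w \<in> W" for w
    proof -
      have "w \<in> vec.span {u, v}" using that S uv by auto
      then obtain \<alpha> \<beta> where "w - \<alpha> *s u - \<beta> *s v = 0" by (auto simp: vec.span_breakdown_eq)
      then show ?thesis by (intro exI[of _ \<alpha>] exI[of _ \<beta>]) (simp add: algebra_simps)
    qed
  qed
qed

text \<open>Affine charts of the Grassmannian of planes. The four entries \<open>x $ a\<close>,
  \<open>x $ b\<close>, \<open>y $ a\<close>, \<open>y $ b\<close> serve as the parameters of a
  line, and the indices select one of finitely many charts.\<close>

lemma dim2_echelon:
  fixes W :: "(complex ^ 4) set"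
  assumes "vec.subspace W" "vec.dim W = 2"
  obtains x y p q a b where "x \<in> W" "y \<in> W" "x $ p = 1" "x $ q = 0" "y $ p = 0" "y $ q = 1"
    "x = axis p 1 + x $ a *s axis a 1 + x $ b *s axis b 1"
    "y = axis q 1 + y $ a *s axis a 1 + y $ b *s axis b 1"
    "\<forall>w\<in>W. w = w $ p *s x + w $ q *s y"
    "a \<noteq> b" "a \<noteq> p" "a \<noteq> q" "b \<noteq> p" "b \<noteq> q"
proof -
  obtain u v where uv: "u \<in> W" "v \<in> W"
    "\<And>\<alpha> \<beta>. \<alpha> *s u + \<beta> *s v = 0 \<Longrightarrow> \<alpha> = 0 \<and> \<beta> = 0"
    "\<And>w. w \<in> W \<Longrightarrow> \<exists>\<alpha> \<beta>. w = \<alpha> *s u + \<beta> *s v"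
    using dim2_basis[OF assms] by metis
  have "u \<noteq> 0" using uv(3)[of 1 0] by auto
  then obtain p where p: "u $ p \<noteq> 0" by (metis vec_eq_iff zero_index)
  define y0 where "y0 = v - (v $ p / u $ p) *s u"
  have "y0 \<noteq> 0"
  proof
    assume "y0 = 0"
    then have "(- (v $ p / u $ p)) *s u + 1 *s v = 0" by (simp add: y0_def)
    from uv(3)[OF this] show False by simp
  qed
  then obtain q where q: "y0 $ q \<noteq> 0" by (metis vec_eq_iff zero_index)
  have y0p: "y0 $ p = 0" using p by (simp add: y0_def)
  define y where "y = (1 / y0 $ q) *s y0"
  define x where "x = (1 / u $ p) *s u - (u $ q / u $ p) *s y"
  have xy: "x $ p = 1" "x $ q = 0" "y $ p = 0" "y $ q = 1"
    using p q y0p by (auto simp: x_def y_def)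
  have "p \<noteq> q" using q y0p by auto
  have y0W: "y0 \<in> W" unfolding y0_def
    by (intro vec.subspace_diff vec.subspace_scale assms uv)
  then have "y \<in> W" unfolding y_def by (intro vec.subspace_scale assms)
  then have "x \<in> W" unfolding x_def by (intro vec.subspace_diff vec.subspace_scale assms uv)
  have u: "u = u $ p *s x + u $ q *s y"
    using p by (simp add: x_def vec_eq_iff field_simps)
  have v: "v = v $ p *s x + v $ q *s y"
  proof -
    have "y0 = y0 $ q *s y" using q by (simp add: y_def)
    moreover have "v = y0 + (v $ p / u $ p) *s u" by (simp add: y0_def)
    moreover have "y0 $ q = v $ q - v $ p / u $ p * u $ q" by (simp add: y0_def)
    ultimately have "v = (v $ q - v $ p / u $ p * u $ q) *s y + (v $ p / u $ p) *s (u $ p *s x + u $ q *s y)"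
      using u by metis
    also have "\<dots> = v $ p *s x + v $ q *s y" using p by (simp add: vec_eq_iff field_simps)
    finally show ?thesis .
  qed
  have span: "w = w $ p *s x + w $ q *s y" if wW: "w \<in> W" for w
  proof -
    obtain \<alpha> \<beta> where w: "w = \<alpha> *s u + \<beta> *s v" using uv(4)[OF wW] by blast
    have "w = \<alpha> *s (u $ p *s x + u $ q *s y) + \<beta> *s (v $ p *s x + v $ q *s y)"
      using w u v by metis
    also have "\<dots> = w $ p *s x + w $ q *s y"
      unfolding w by (simp add: vec_eq_iff algebra_simps)
    finally show ?thesis .
  qed
  have "card (UNIV - {p, q}) = 2" using \<open>p \<noteq> q\<close> by (simp add: card_Diff_subset)
  then obtain a b where ab: "UNIV - {p, q} = {a, b}" "a \<noteq> b" by (auto simp: card_2_iff)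
  then have ab': "a \<noteq> p" "a \<noteq> q" "b \<noteq> p" "b \<noteq> q" by auto
  have cases: "i = p \<or> i = q \<or> i = a \<or> i = b" for i using ab(1) by blast
  have "x = axis p 1 + x $ a *s axis a 1 + x $ b *s axis b 1"
    unfolding vec_eq_iff
  proof
    fix i show "x $ i = (axis p 1 + x $ a *s axis a 1 + x $ b *s axis b 1) $ i"
      using cases[of i] ab(2) ab' xy \<open>p \<noteq> q\<close> by (auto simp: axis_def)
  qed
  moreover have "y = axis q 1 + y $ a *s axis a 1 + y $ b *s axis b 1"
    unfolding vec_eq_iff
  proof
    fix i show "y $ i = (axis q 1 + y $ a *s axis a 1 + y $ b *s axis b 1) $ i"
      using cases[of i] ab(2) ab' xy \<open>p \<noteq> q\<close> by (auto simp: axis_def)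
  qed
  ultimately show ?thesis
    using that[of x y p q a b, OF \<open>x \<in> W\<close> \<open>y \<in> W\<close> xy] span ab(2) ab' by blast
qed

lemma normalized_vector:
  fixes x :: "complex ^ 4"
  assumes "x $ p = 1"
  obtains a b c where "x = axis p 1 + x $ a *s axis a 1 + x $ b *s axis b 1 + x $ c *s axis c 1"
proof -
  have "card (UNIV - {p}) = 3" by (simp add: card_Diff_subset)
  then obtain a b c where ab: "UNIV - {p} = {a, b, c}" "a \<noteq> b" "b \<noteq> c" "a \<noteq> c"
    unfolding card_3_iff by blast
  then have ab': "a \<noteq> p" "b \<noteq> p" "c \<noteq> p" by auto
  have cases: "i = p \<or> i = a \<or> i = b \<or> i = c" for i using ab(1) by blast
  have "x = axis p 1 + x $ a *s axis a 1 + x $ b *s axis b 1 + x $ c *s axis c 1"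
    unfolding vec_eq_iff
  proof
    fix i show "x $ i = (axis p 1 + x $ a *s axis a 1 + x $ b *s axis b 1 + x $ c *s axis c 1) $ i"
      using cases[of i] ab ab' assms by (auto simp: axis_def)
  qed
  then show ?thesis by (rule that)
qed

text \<open>The dimension of the sum is 2 + 2 - 0 = 4, so two skew lines give a direct sum
  decomposition of the whole space.\<close>

lemma complementary_planes:
  fixes W W' :: "(complex ^ 4) set"
  assumes "vec.subspace W" "vec.dim W = 2" "vec.subspace W'" "vec.dim W' = 2" "W \<inter> W' \<subseteq> {0}"
  obtains u v where "u \<in> W" "v \<in> W'" "y = u + v"
proof -
  have "vec.dim (W \<inter> W') = 0" using assms(5) by (simp add: vec.dim_eq_0)
  then have "vec.dim {x + y |x y. x \<in> W \<and> y \<in> W'} = 4"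
    using vec.dim_sums_Int[OF assms(1,3)] assms(2,4) by linarith
  then have "vec.span {x + y |x y. x \<in> W \<and> y \<in> W'} = UNIV"
    using vec.dim_eq_full[of "{x + y |x y. x \<in> W \<and> y \<in> W'}"] by (simp add: vec_dim_card vec.dimension_def card_cart_basis)
  moreover have "vec.span {x + y |x y. x \<in> W \<and> y \<in> W'} = {x + y |x y. x \<in> W \<and> y \<in> W'}"
    unfolding vec.span_eq_iff by (rule vec.subspace_sums[OF assms(1,3)])
  ultimately have "{x + y |x y. x \<in> W \<and> y \<in> W'} = UNIV" by (rule subst[rotated])
  then have "y \<in> {x + y |x y. x \<in> W \<and> y \<in> W'}" by simp
  then show ?thesis using that by blast
qed

lemma span_insert_subspace:
  assumes "vec.subspace W"
  shows "l \<in> vec.span (insert x W) \<longleftrightarrow> (\<exists>w\<in>W. \<exists>c. l = w + c *s x)"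
proof -
  have "vec.span W = W" using assms by (simp only: vec.span_eq_iff)
  then have "l \<in> vec.span (insert x W) \<longleftrightarrow> (\<exists>c. l - c *s x \<in> W)"
    by (simp only: vec.span_breakdown_eq)
  also have "\<dots> \<longleftrightarrow> (\<exists>w\<in>W. \<exists>c. l = w + c *s x)"
  proof safe
    fix c assume "l - c *s x \<in> W"
    then show "\<exists>w\<in>W. \<exists>c. l = w + c *s x"
      by (intro bexI[of _ "l - c *s x"] exI[of _ c]) simp_all
  next
    fix w c assume "w \<in> W"
    then show "\<exists>c'. w + c *s x - c' *s x \<in> W" by (intro exI[of _ c]) simp
  qed
  finally show ?thesis .
qed

lemma dir_deriv_smult: "dir_deriv F x (c *s l) = c * dir_deriv F x l"
  by (simp add: dir_deriv_def sum_distrib_left mult.assoc)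

lemma dir_deriv_scale_point:
  assumes "homogeneous n F" "\<And>l. dir_deriv F x l = 0" "c \<noteq> 0"
  shows "dir_deriv F (c *s x) l = 0"
  using dir_deriv_scale_arg[OF assms(1), of c x "(1 / c) *s l"] assms(2,3) by simp

section \<open>Families cut out by independent linear conditions\<close>

text \<open>Independence on \<open>V\<close> is demanded at the witnessing parameter
  \<open>t\<close>, as part of membership. Thinness then needs no geometric hypothesis, and
  degenerate parameters can be treated by a different family.\<close>

definition piece ::
    "4 cpoly set \<Rightarrow> nat \<Rightarrow> (nat \<Rightarrow> (nat \<Rightarrow> complex) \<Rightarrow> complex ^ 4) \<Rightarrow>
      (nat \<Rightarrow> (nat \<Rightarrow> complex) \<Rightarrow> complex ^ 4) \<Rightarrow> 4 cpoly set" where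
  "piece V r x l = {F \<in> V. \<exists>t.
     (\<forall>\<mu>. (\<forall>G\<in>V. (\<Sum>i<r. \<mu> i * dir_deriv G (x i t) (l i t)) = 0) \<longrightarrow> (\<forall>i<r. \<mu> i = 0)) \<and>
     (\<forall>i<r. dir_deriv F (x i t) (l i t) = 0)}"

lemma polyf_eval_cpoly:
  assumes "\<And>i. (\<lambda>t. x t $ i) \<in> polyf m" shows "(\<lambda>t. eval_cpoly (($) (x t)) F) \<in> polyf m"
  unfolding eval_cpoly_def by (intro polyf_sum polyf.mult polyf.const polyf_prod polyf_power assms)

lemma thin_piece:
  assumes J: "finite J" "\<And>j. j \<in> J \<Longrightarrow> b j \<in> V"
    "\<And>F. F \<in> V \<Longrightarrow> F = (\<Sum>j\<in>J. fs_scale (Poly_Mapping.lookup F j) (b j))"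
    and x: "\<And>i k. i < r \<Longrightarrow> (\<lambda>t. x i t $ k) \<in> polyf m"
    and l: "\<And>i k. i < r \<Longrightarrow> (\<lambda>t. l i t $ k) \<in> polyf m" and mr: "m < r"
  shows "thin J (Poly_Mapping.lookup ` piece V r x l)"
proof -
  define \<phi> where "\<phi> i j = (\<lambda>t. dir_deriv (b j) (x i t) (l i t))" for i j
  have "\<phi> i j \<in> polyf m" if "i < r" for i j
    unfolding \<phi>_def dir_deriv_def
    by (intro polyf_sum polyf.mult polyf_eval_cpoly x l that)
  then have thin: "thin J {c. \<exists>t.
    (\<forall>\<mu>. (\<forall>j\<in>J. (\<Sum>i<r. \<mu> i * \<phi> i j t) = 0) \<longrightarrow> (\<forall>i<r. \<mu> i = 0)) \<and>
    (\<forall>i<r. (\<Sum>j\<in>J. \<phi> i j t * c j) = 0)}"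
    by (intro thin_kernels[OF J(1) _ mr])
  have dd: "dir_deriv F (x i t) (l i t) = (\<Sum>j\<in>J. \<phi> i j t * Poly_Mapping.lookup F j)"
    if "F \<in> V" for F i t
    by (subst J(3)[OF that]) (simp add: dir_deriv_lincomb \<phi>_def mult.commute)
  show ?thesis
  proof (rule thin_subset[OF thin], safe)
    fix F assume "F \<in> piece V r x l"
    then obtain t where F: "F \<in> V" "\<forall>i<r. dir_deriv F (x i t) (l i t) = 0"
      "\<forall>\<mu>. (\<forall>G\<in>V. (\<Sum>i<r. \<mu> i * dir_deriv G (x i t) (l i t)) = 0) \<longrightarrow> (\<forall>i<r. \<mu> i = 0)"
      unfolding piece_def by blast
    have "\<forall>i<r. \<mu> i = 0" if \<mu>: "\<forall>j\<in>J. (\<Sum>i<r. \<mu> i * \<phi> i j t) = 0" for \<mu>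
    proof -
      have "(\<Sum>i<r. \<mu> i * dir_deriv G (x i t) (l i t)) = 0" if "G \<in> V" for G
      proof -
        have "(\<Sum>i<r. \<mu> i * dir_deriv G (x i t) (l i t)) =
          (\<Sum>i<r. \<Sum>j\<in>J. Poly_Mapping.lookup G j * (\<mu> i * \<phi> i j t))"
          by (simp add: dd[OF that] sum_distrib_left mult_ac)
        also have "\<dots> = (\<Sum>j\<in>J. Poly_Mapping.lookup G j * (\<Sum>i<r. \<mu> i * \<phi> i j t))"
          by (subst sum.swap) (simp add: sum_distrib_left)
        also have "\<dots> = 0" using \<mu> by simp
        finally show ?thesis .
      qed
      then show ?thesis using F(3) by blast
    qed
    then show "\<exists>t. (\<forall>\<mu>. (\<forall>j\<in>J. (\<Sum>i<r. \<mu> i * \<phi> i j t) = 0) \<longrightarrow> (\<forall>i<r. \<mu> i = 0)) \<and>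
      (\<forall>i<r. (\<Sum>j\<in>J. \<phi> i j t * Poly_Mapping.lookup F j) = 0)"
      using F(2) dd[OF F(1)] by (intro exI[of _ t]) auto
  qed
qed

section \<open>Forms vanishing on skew lines\<close>

locale line_configuration =
  fixes d k :: nat and W :: "nat \<Rightarrow> (complex ^ 4) set"
  assumes k_le: "k \<le> d" and k_pos: "k > 0" and d_ge: "d \<ge> 4"
    and plane: "\<And>s. s < k \<Longrightarrow> vec.subspace (W s)" "\<And>s. s < k \<Longrightarrow> vec.dim (W s) = 2"
    and skew: "\<And>s s'. s < k \<Longrightarrow> s' < k \<Longrightarrow> s \<noteq> s' \<Longrightarrow> W s \<inter> W s' \<subseteq> {0}"
begin

definition V :: "4 cpoly set" where
  "V = {F. homogeneous d F \<and> (\<forall>s<k. \<forall>x\<in>W s. eval_cpoly (($) x) F = 0)}"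

text \<open>A product of \<open>d\<close> linear forms lies in \<open>V\<close> as soon as its \<open>s\<close>-th factor vanishes on
  \<open>U s\<close>; the factors with \<open>s \<ge> k\<close> are unconstrained.\<close>

definition U :: "nat \<Rightarrow> (complex ^ 4) set" where
  "U s = (if s < k then W s else {0})"

lemma subspace_U: "vec.subspace (U s)"
  by (simp add: U_def plane vec.subspace_single_0)

lemma U_disjoint: "s \<noteq> s' \<Longrightarrow> x \<in> U s \<Longrightarrow> x \<in> U s' \<Longrightarrow> x = 0"
  using skew[of s s'] by (auto simp: U_def split: if_splits)

lemma V_homogeneous: "F \<in> V \<Longrightarrow> homogeneous d F"
  by (simp add: V_def)

lemma V_add: "F \<in> V \<Longrightarrow> G \<in> V \<Longrightarrow> F + G \<in> V"
  by (simp add: V_def homogeneous_add eval_cpoly_add)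

lemma V_scale: "F \<in> V \<Longrightarrow> fs_scale c F \<in> V"
  by (simp add: V_def homogeneous_fs_scale eval_cpoly_fs_scale)

lemma V_zero: "0 \<in> V"
  by (simp add: V_def homogeneous_zero)

lemma prod_linear_V:
  assumes "\<And>s u. s < d \<Longrightarrow> u \<in> U s \<Longrightarrow> form (a s) u = 0"
  shows "(\<Prod>s<d. linear_cpoly (a s)) \<in> V"
  unfolding V_def
proof (intro CollectI conjI allI impI ballI)
  show "homogeneous d (\<Prod>s<d. linear_cpoly (a s))"
    using homogeneous_prod[of "{..<d}" "\<lambda>s. linear_cpoly (a s)"] homogeneous_linear_cpoly by simp
  fix s x assume "s < k" "x \<in> W s"
  then have "s < d" "form (a s) x = 0" using k_le assms[of s x] by (auto simp: U_def)
  then show "eval_cpoly (($) x) (\<Prod>s<d. linear_cpoly (a s)) = 0"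
    by (auto simp: eval_cpoly_prod eval_linear_cpoly intro!: prod_zero)
qed

text \<open>If \<open>l\<close> lay outside, a linear form \<open>b\<close> could vanish on
  \<open>x\<close> and \<open>U s0\<close> but not at \<open>l\<close>. Multiplied by forms through
  the other \<open>U s\<close> that are nonzero at \<open>x\<close>, it gives a member of
  \<open>V\<close> whose derivative along \<open>l\<close> is nonzero.\<close>

lemma tangent_vanishing:
  assumes "s0 < d" "\<And>s. s < d \<Longrightarrow> s \<noteq> s0 \<Longrightarrow> x \<notin> U s"
    and "\<And>F. F \<in> V \<Longrightarrow> dir_deriv F x l = 0"
  shows "l \<in> vec.span (insert x (U s0))"
proof (rule ccontr)
  assume "\<not> ?thesis"
  with separating_form[OF vec.subspace_span] obtain b where
    b: "\<forall>u\<in>vec.span (insert x (U s0)). form b u = 0" "form b l \<noteq> 0" by blast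
  have "\<forall>s. \<exists>a. s < d \<longrightarrow> s \<noteq> s0 \<longrightarrow> (\<forall>u\<in>U s. form a u = 0) \<and> form a x \<noteq> 0"
    using assms(2) separating_form[OF subspace_U] by blast
  from choice[OF this] obtain a where
    a: "\<forall>s. s < d \<longrightarrow> s \<noteq> s0 \<longrightarrow> (\<forall>u\<in>U s. form (a s) u = 0) \<and> form (a s) x \<noteq> 0" ..
  define a' where "a' = a(s0 := b)"
  have "(\<Prod>s<d. linear_cpoly (a' s)) \<in> V"
    using a b by (intro prod_linear_V) (auto simp: a'_def vec.span_base)
  moreover have "dir_deriv (\<Prod>s<d. linear_cpoly (a' s)) x l = form (a' s0) l * (\<Prod>s\<in>{..<d} - {s0}. form (a' s) x)"
    using b by (intro dir_deriv_prod_linear) (auto simp: a'_def assms vec.span_base)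
  moreover have "\<dots> \<noteq> 0" using a b by (auto simp: a'_def prod_zero_iff)
  ultimately show False using assms(3) by metis
qed

lemma nonvanishing_section:
  assumes "\<And>s. s < d \<Longrightarrow> x \<notin> U s" obtains F where "F \<in> V" "eval_cpoly (($) x) F \<noteq> 0"
proof -
  have "\<forall>s. \<exists>a. s < d \<longrightarrow> (\<forall>u\<in>U s. form a u = 0) \<and> form a x \<noteq> 0"
    using assms separating_form[OF subspace_U] by blast
  from choice[OF this] obtain a where
    a: "\<forall>s. s < d \<longrightarrow> (\<forall>u\<in>U s. form (a s) u = 0) \<and> form (a s) x \<noteq> 0" ..
  have "(\<Prod>s<d. linear_cpoly (a s)) \<in> V" using a by (intro prod_linear_V) auto
  moreover have "eval_cpoly (($) x) (\<Prod>s<d. linear_cpoly (a s)) \<noteq> 0"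
    using a by (auto simp: eval_cpoly_prod eval_linear_cpoly prod_zero_iff)
  ultimately show ?thesis by (rule that)
qed

text \<open>Each of the first four linear factors vanishes on its own \<open>U s\<close> and
  additionally at one of the four points other than \<open>P i0\<close>; \<open>d \<ge> 4\<close>
  ensures that these factors exist.\<close>

lemma interpolation:
  fixes P :: "nat \<Rightarrow> complex ^ 4"
  assumes "i0 < 5" and P: "\<And>s. s < d \<Longrightarrow> P i0 \<notin> U s"
    "\<And>i s. i < 5 \<Longrightarrow> i \<noteq> i0 \<Longrightarrow> s < d \<Longrightarrow> P i0 \<notin> vec.span (insert (P i) (U s))"
  obtains F where "F \<in> V" "eval_cpoly (($) (P i0)) F \<noteq> 0"
    "\<And>i. i < 5 \<Longrightarrow> i \<noteq> i0 \<Longrightarrow> eval_cpoly (($) (P i)) F = 0"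
proof -
  \<comment> \<open>Enumerates the four indices different from \<open>i0\<close>.\<close>
  define \<sigma> where "\<sigma> s = (if s < i0 then s else s + 1)" for s
  have \<sigma>: "\<sigma> s < 5" "\<sigma> s \<noteq> i0" if "s < 4" for s using that by (auto simp: \<sigma>_def)
  have "\<forall>s. \<exists>a. s < d \<longrightarrow> (\<forall>u\<in>U s. form a u = 0) \<and> (s < 4 \<longrightarrow> form a (P (\<sigma> s)) = 0) \<and> form a (P i0) \<noteq> 0"
  proof
    fix s
    show "\<exists>a. s < d \<longrightarrow> (\<forall>u\<in>U s. form a u = 0) \<and> (s < 4 \<longrightarrow> form a (P (\<sigma> s)) = 0) \<and> form a (P i0) \<noteq> 0"
    proof (cases "s < d")
      case True
      show ?thesis
      proof (cases "s < 4")
        case True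
        then have "P i0 \<notin> vec.span (insert (P (\<sigma> s)) (U s))" using P(2) \<sigma> \<open>s < d\<close> by blast
        from separating_form[OF vec.subspace_span this] show ?thesis
          by (meson insertI1 insertI2 vec.span_base)
      next
        case False
        with separating_form[OF subspace_U P(1)[OF \<open>s < d\<close>]] show ?thesis by blast
      qed
    qed simp
  qed
  from choice[OF this] obtain a where
    a: "\<forall>s. s < d \<longrightarrow> (\<forall>u\<in>U s. form (a s) u = 0) \<and> (s < 4 \<longrightarrow> form (a s) (P (\<sigma> s)) = 0) \<and> form (a s) (P i0) \<noteq> 0" ..
  show ?thesis
  proof (rule that)
    show "(\<Prod>s<d. linear_cpoly (a s)) \<in> V" using a by (intro prod_linear_V) auto
    show "eval_cpoly (($) (P i0)) (\<Prod>s<d. linear_cpoly (a s)) \<noteq> 0"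
      using a by (auto simp: eval_cpoly_prod eval_linear_cpoly prod_zero_iff)
    fix i :: nat assume i: "i < 5" "i \<noteq> i0"
    define s where "s = (if i < i0 then i else i - 1)"
    have "s < 4" "\<sigma> s = i" using i assms(1) by (auto simp: s_def \<sigma>_def)
    then have "s < d" "form (a s) (P i) = 0" using a d_ge by auto
    then show "eval_cpoly (($) (P i)) (\<Prod>s<d. linear_cpoly (a s)) = 0"
      by (auto simp: eval_cpoly_prod eval_linear_cpoly intro!: prod_zero)
  qed
qed

end

section \<open>The families of bad forms\<close>

locale coordinatized_configuration = line_configuration +
  fixes J :: "(4 \<Rightarrow>\<^sub>0 nat) set" and b :: "(4 \<Rightarrow>\<^sub>0 nat) \<Rightarrow> 4 cpoly"
  assumes coord: "finite J" "\<And>j. j \<in> J \<Longrightarrow> b j \<in> V"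
    "\<And>F. F \<in> V \<Longrightarrow> F = (\<Sum>j\<in>J. fs_scale (Poly_Mapping.lookup F j) (b j))"
begin

text \<open>Four parameters chart the line and five of its points give conditions. Since
  \<open>L\<close> meets no \<open>W s\<close>, the span of one point and \<open>U s\<close>
  contains no other of these points, so \<open>interpolation\<close> shows that the five evaluations
  are independent.\<close>

lemma thin_with_line:
  "thin J (Poly_Mapping.lookup ` {F \<in> V. \<exists>L. vec.subspace L \<and> vec.dim L = 2 \<and>
     (\<forall>s<k. L \<inter> W s \<subseteq> {0}) \<and> (\<forall>x\<in>L. eval_cpoly (($) x) F = 0)})" (is "thin J (_ ` ?B)")
proof -
  define X where "X p a c t = axis p 1 + t 0 *s axis a 1 + t 1 *s axis c (1::complex)"
    for p a c :: 4 and t :: "nat \<Rightarrow> complex"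
  define Y where "Y q a c t = axis q 1 + t 2 *s axis a 1 + t 3 *s axis c (1::complex)"
    for q a c :: 4 and t :: "nat \<Rightarrow> complex"
  define P where "P = (\<lambda>(p, q, a, c) i t. X p a c t + of_nat i *s Y q a c t)"
  \<comment> \<open>Point and direction coincide, so by Euler's identity the conditions are
    vanishing at the points. The points differ because, after normalization, their
    \<open>q\<close>-entries are 0, 1, 2, 3, 4.\<close>
  have "thin J (Poly_Mapping.lookup ` piece V 5 (P z) (P z))" for z
  proof (rule thin_piece[OF coord])
    show "(\<lambda>t. P z i t $ j) \<in> polyf 4" for i j
      by (cases z) (auto simp: P_def X_def Y_def intro!: polyf.intros)
    show "(\<lambda>t. P z i t $ j) \<in> polyf 4" for i j
      by (cases z) (auto simp: P_def X_def Y_def intro!: polyf.intros)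
  qed simp_all
  then have thin: "thin J (\<Union>z\<in>UNIV. Poly_Mapping.lookup ` piece V 5 (P z) (P z))"
    by (intro thin_UN) auto
  have "?B \<subseteq> (\<Union>z\<in>UNIV. piece V 5 (P z) (P z))"
  proof
    fix F assume "F \<in> ?B"
    then obtain L where F: "F \<in> V" and L: "vec.subspace L" "vec.dim L = 2"
      "\<forall>s<k. L \<inter> W s \<subseteq> {0}" "\<forall>x\<in>L. eval_cpoly (($) x) F = 0" by blast
    obtain x y p q a c where xy: "x \<in> L" "y \<in> L" "x $ p = 1" "x $ q = 0" "y $ p = 0" "y $ q = 1"
      "x = axis p 1 + x $ a *s axis a 1 + x $ c *s axis c 1"
      "y = axis q 1 + y $ a *s axis a 1 + y $ c *s axis c 1"
      by (rule dim2_echelon[OF L(1,2)])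
    define t where "t i = (if i = 0 then x $ a else if i = 1 then x $ c else if i = 2 then y $ a else y $ c)"
      for i :: nat
    define Q where "Q i = x + of_nat i *s y" for i :: nat
    have "X p a c t = x" "Y q a c t = y"
      using xy(7,8) by (simp_all add: X_def Y_def t_def)
    then have PQ: "P (p, q, a, c) i t = Q i" for i by (simp add: P_def Q_def)
    have QL: "Q i \<in> L" for i unfolding Q_def using L(1) xy by (intro vec.subspace_add vec.subspace_scale)
    have LU: "u = 0" if "u \<in> L" "u \<in> U s" for u s
      using that L(3) by (auto simp: U_def split: if_splits)
    have Qp: "Q i $ p = 1" "Q i $ q = of_nat i" for i using xy by (simp_all add: Q_def)
    have indep: "\<forall>i<5. \<mu> i = 0" if \<mu>: "\<forall>G\<in>V. (\<Sum>i<5. \<mu> i * dir_deriv G (Q i) (Q i)) = 0" for \<mu>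
    proof (intro allI impI)
      fix i0 :: nat assume i0: "i0 < 5"
      have 1: "Q i0 \<notin> U s" for s using LU[OF QL] Qp(1)[of i0] by force
      have 2: "Q i0 \<notin> vec.span (insert (Q i) (U s))" if "i \<noteq> i0" for i s
      proof
        assume "Q i0 \<in> vec.span (insert (Q i) (U s))"
        then obtain w e where w: "w \<in> U s" "Q i0 = w + e *s Q i"
          unfolding span_insert_subspace[OF subspace_U] by blast
        then have "w = Q i0 - e *s Q i" by simp
        then have "w \<in> L" using QL L(1) by (simp add: vec.subspace_diff vec.subspace_scale)
        then have "Q i0 = e *s Q i" using LU w by simp
        then have "e = 1" "of_nat i0 = e * of_nat i" using Qp by (metis vector_smult_component mult.right_neutral)+
        then show False using that by simp
      qed
      obtain G where G: "G \<in> V" "eval_cpoly (($) (Q i0)) G \<noteq> 0"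
        "\<And>i. i < 5 \<Longrightarrow> i \<noteq> i0 \<Longrightarrow> eval_cpoly (($) (Q i)) G = 0"
        using interpolation[of i0 Q, OF i0 1 2] by blast
      have "0 = (\<Sum>i<5. \<mu> i * dir_deriv G (Q i) (Q i))" using \<mu> G by simp
      also have "\<dots> = (\<Sum>i<5. if i = i0 then \<mu> i0 * (of_nat d * eval_cpoly (($) (Q i0)) G) else 0)"
        by (rule sum.cong) (use G(3) in \<open>auto simp: dir_deriv_euler[OF V_homogeneous[OF G(1)]]\<close>)
      also have "\<dots> = \<mu> i0 * (of_nat d * eval_cpoly (($) (Q i0)) G)" using i0 by simp
      finally show "\<mu> i0 = 0" using G(2) d_ge by simp
    qed
    have "\<forall>i<5. dir_deriv F (Q i) (Q i) = 0"
      using L(4) QL by (simp add: dir_deriv_euler[OF V_homogeneous[OF F]])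
    then have "F \<in> piece V 5 (P (p, q, a, c)) (P (p, q, a, c))"
      unfolding piece_def using F indep by (intro CollectI conjI exI[of _ t]) (auto simp: PQ)
    then show "F \<in> (\<Union>z\<in>UNIV. piece V 5 (P z) (P z))" by blast
  qed
  then show ?thesis by (rule thin_subset[OF thin image_mono[THEN subset_trans[OF _ eq_refl[OF image_UN]]]])
qed

text \<open>Every member of \<open>V\<close> already has zero derivative along \<open>W s\<close>,
  so conditions are imposed only in two directions complementary to \<open>W s\<close>: two
  conditions against one parameter for the point.\<close>

lemma thin_singular_on_line:
  assumes s: "s < k"
  shows "thin J (Poly_Mapping.lookup `
    {F \<in> V. \<exists>x\<in>W s. x \<noteq> 0 \<and> (\<forall>l. dir_deriv F x l = 0)})" (is "thin J (_ ` ?B)")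
proof -
  obtain x y p q a c where xy: "x \<in> W s" "y \<in> W s" "x $ p = 1" "x $ q = 0" "y $ p = 0" "y $ q = 1"
      "\<forall>w\<in>W s. w = w $ p *s x + w $ q *s y"
      "a \<noteq> c" "a \<noteq> p" "a \<noteq> q" "c \<noteq> p" "c \<noteq> q"
    by (rule dim2_echelon[OF plane[OF s]])
  define l where "l i = (if i = 0 then axis a 1 else axis c (1::complex))" for i :: nat
  have piece: "F \<in> piece V 2 (\<lambda>_ t. u + t 0 *s v) (\<lambda>i _. l i)"
    if F: "F \<in> V" "\<forall>l. dir_deriv F (u + t *s v) l = 0" "u + t *s v \<in> W s" "u + t *s v \<noteq> 0" for F u v t
  proof -
    let ?x = "u + t *s v"
    have "\<forall>i<2. \<mu> i = 0" if \<mu>: "\<forall>G\<in>V. (\<Sum>i<2. \<mu> i * dir_deriv G ?x (l i)) = 0" for \<mu>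
    proof -
      define w where "w = (\<Sum>i<2. \<mu> i *s l i)"
      have "w \<in> vec.span (insert ?x (U s))"
      proof (rule tangent_vanishing)
        show "s < d" using s k_le by simp
        show "?x \<notin> U s'" if "s' \<noteq> s" for s'
          using U_disjoint[OF that, of ?x] F s by (auto simp: U_def)
        show "dir_deriv G ?x w = 0" if "G \<in> V" for G
          unfolding w_def dir_deriv_combine using \<mu> that by blast
      qed
      then have "w \<in> W s" using F(3) s plane(1)[OF s]
        by (metis U_def insert_absorb vec.span_eq_iff)
      moreover have w: "w = \<mu> 0 *s axis a 1 + \<mu> 1 *s axis c 1"
        by (simp add: w_def l_def numeral_2_eq_2)
      moreover have "w $ p = 0" "w $ q = 0" using xy by (auto simp: w axis_def)
      ultimately have "w = 0" using xy(7) by fastforce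
      then have "w $ a = 0" "w $ c = 0" by simp_all
      then have "\<mu> 0 = 0" "\<mu> 1 = 0" using xy(8) by (auto simp: w axis_def)
      then show ?thesis by (auto simp: less_2_cases_iff)
    qed
    then show ?thesis unfolding piece_def using F
      by (intro CollectI conjI exI[of _ "\<lambda>_. t"]) auto
  qed
  have thin: "thin J (Poly_Mapping.lookup ` piece V 2 (\<lambda>_ t. u + t 0 *s v) (\<lambda>i _. l i))" for u v
    by (rule thin_piece[OF coord, where m = 1]) (auto intro!: polyf.intros)
  \<comment> \<open>The two affine charts of the projective line; the second one serves the point
    \<open>y\<close> only.\<close>
  have "?B \<subseteq> piece V 2 (\<lambda>_ t. x + t 0 *s y) (\<lambda>i _. l i) \<union> piece V 2 (\<lambda>_ t. y + t 0 *s x) (\<lambda>i _. l i)"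
  proof
    fix F assume "F \<in> ?B"
    then obtain z where F: "F \<in> V" and z: "z \<in> W s" "z \<noteq> 0" "\<And>l. dir_deriv F z l = 0" by blast
    have zW: "e *s z \<in> W s" for e using z plane[OF s] by (simp add: vec.subspace_scale)
    have sing: "dir_deriv F (e *s z) l = 0" if "e \<noteq> 0" for e l
      by (rule dir_deriv_scale_point[OF V_homogeneous[OF F] z(3) that])
    consider "z $ p \<noteq> 0" | "z $ p = 0" "z $ q \<noteq> 0" using bspec[OF xy(7) z(1)] z(2) by fastforce
    then show "F \<in> piece V 2 (\<lambda>_ t. x + t 0 *s y) (\<lambda>i _. l i) \<union> piece V 2 (\<lambda>_ t. y + t 0 *s x) (\<lambda>i _. l i)"
    proof cases
      case 1
      have eq: "x + (z $ q / z $ p) *s y = (1 / z $ p) *s z"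
        using 1 by (subst (3) bspec[OF xy(7) z(1)]) (simp add: vec_eq_iff field_simps)
      have "F \<in> piece V 2 (\<lambda>_ t. x + t 0 *s y) (\<lambda>i _. l i)"
        by (rule piece[where t = "z $ q / z $ p"], unfold eq) (use 1 F zW sing z in auto)
      then show ?thesis ..
    next
      case 2
      have eq: "y + 0 *s x = (1 / z $ q) *s z"
        using 2 by (subst (2) bspec[OF xy(7) z(1)]) (simp add: vec_eq_iff field_simps)
      have "F \<in> piece V 2 (\<lambda>_ t. y + t 0 *s x) (\<lambda>i _. l i)"
        by (rule piece[where t = 0], unfold eq) (use 2 F zW sing z in auto)
      then show ?thesis ..
    qed
  qed
  then have "Poly_Mapping.lookup ` ?B \<subseteq> Poly_Mapping.lookup ` piece V 2 (\<lambda>_ t. x + t 0 *s y) (\<lambda>i _. l i)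
      \<union> Poly_Mapping.lookup ` piece V 2 (\<lambda>_ t. y + t 0 *s x) (\<lambda>i _. l i)" by blast
  then show ?thesis by (rule thin_subset[OF thin_Un[OF thin thin]])
qed

text \<open>At a point satisfying this condition, \<open>V\<close> separates 1-jets.\<close>

definition generic_point :: "complex ^ 4 \<Rightarrow> bool" where
  "generic_point x \<longleftrightarrow> (\<forall>l. (\<forall>s<d. l \<in> vec.span (insert x (U s))) \<longrightarrow> (\<exists>e. l = e *s x))"

text \<open>Three parameters against four partial derivatives. A relation between the conditions is
  a direction \<open>l\<close> annihilated by all of \<open>V\<close>; genericity makes it radial,
  and Euler's identity for a member of \<open>V\<close> nonzero at \<open>x\<close> makes it
  zero.\<close>

lemma thin_singular_at_generic_point:
  "thin J (Poly_Mapping.lookup ` {F \<in> V. \<exists>x p. x $ p = 1 \<and> (\<forall>s<d. x \<notin> U s) \<and> generic_point x \<and>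
     (\<forall>l. dir_deriv F x l = 0)})" (is "thin J (_ ` ?B)")
proof -
  have "card (UNIV :: 4 set) = 4" by simp
  then obtain e :: "nat \<Rightarrow> 4" where e: "bij_betw e {0..<4} UNIV"
    using ex_bij_betw_nat_finite[of "UNIV :: 4 set"] by auto
  define X where "X = (\<lambda>(p, a, b, c) (t :: nat \<Rightarrow> complex). axis p 1 + t 0 *s axis a 1 + t 1 *s axis b 1
     + t 2 *s axis c (1::complex) :: complex ^ 4)"
  let ?P = "\<lambda>z. piece V 4 (\<lambda>_. X z) (\<lambda>i _. axis (e i) 1)"
  have "thin J (Poly_Mapping.lookup ` ?P z)" for z
    by (rule thin_piece[OF coord, where m = 3]) (cases z, auto simp: X_def intro!: polyf.intros)+
  then have thin: "thin J (\<Union>z\<in>UNIV. Poly_Mapping.lookup ` ?P z)"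
    by (intro thin_UN) auto
  have "?B \<subseteq> (\<Union>z\<in>UNIV. ?P z)"
  proof
    fix F assume "F \<in> ?B"
    then obtain x p where F: "F \<in> V" and x: "x $ p = 1" "\<And>s. s < d \<Longrightarrow> x \<notin> U s" "generic_point x"
      "\<forall>l. dir_deriv F x l = 0" by blast
    obtain a b c where abc: "x = axis p 1 + x $ a *s axis a 1 + x $ b *s axis b 1 + x $ c *s axis c 1"
      by (rule normalized_vector[OF x(1)])
    define t where "t i = (if i = 0 then x $ a else if i = 1 then x $ b else x $ c)" for i :: nat
    have X: "X (p, a, b, c) t = x" using abc by (simp add: X_def t_def)
    have "\<forall>i<4. \<mu> i = 0" if \<mu>: "\<forall>G\<in>V. (\<Sum>i<4. \<mu> i * dir_deriv G x (axis (e i) 1)) = 0" for \<mu>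
    proof -
      define l where "l = (\<Sum>i<4. \<mu> i *s axis (e i) 1)"
      have l: "dir_deriv G x l = 0" if "G \<in> V" for G
        unfolding l_def dir_deriv_combine using \<mu> that by blast
      have "\<forall>s<d. l \<in> vec.span (insert x (U s))"
        using tangent_vanishing[OF _ x(2) l] by blast
      then obtain r where r: "l = r *s x" using x(3) unfolding generic_point_def by blast
      obtain G where G: "G \<in> V" "eval_cpoly (($) x) G \<noteq> 0" using nonvanishing_section[OF x(2)] by blast
      have "r * (of_nat d * eval_cpoly (($) x) G) = 0"
        using l[OF G(1)] r by (simp add: dir_deriv_smult dir_deriv_euler[OF V_homogeneous[OF G(1)]])
      then have "l = 0" using G(2) d_ge r by simp
      have "\<mu> i = l $ e i" if "i < 4" for i
      proof -
        have "l $ e i = (\<Sum>j<4. \<mu> j * (if e i = e j then 1 else 0))"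
          by (simp add: l_def axis_def)
        also have "\<dots> = (\<Sum>j<4. if j = i then \<mu> j else 0)"
          using e that by (intro sum.cong) (auto simp: bij_betw_def inj_on_def)
        finally show ?thesis using that by simp
      qed
      with \<open>l = 0\<close> show ?thesis by simp
    qed
    then have "F \<in> ?P (p, a, b, c)"
      unfolding piece_def using F x(4) by (intro CollectI conjI exI[of _ t]) (auto simp: X)
    then show "F \<in> (\<Union>z\<in>UNIV. ?P z)" by blast
  qed
  then show ?thesis by (rule thin_subset[OF thin image_mono[THEN subset_trans[OF _ eq_refl[OF image_UN]]]])
qed

end

section \<open>Singular points on a transversal of the lines\<close>

context coordinatized_configuration
begin

text \<open>The point \<open>x\<close> lies on the line joining \<open>u + s u'\<close> to
  \<open>v + s v'\<close>. Directions along this transversal may be lost, so only the radial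
  direction, \<open>u'\<close> and \<open>v'\<close> are tested: their span meets the plane of the
  transversal in multiples of \<open>x\<close> alone. A relation vector \<open>w\<close> lies in
  that plane, being in the span of \<open>x\<close> with \<open>W 0\<close> and with
  \<open>W 1\<close>.\<close>

lemma quadric_piece:
  assumes k: "k \<ge> 2" and uv: "u \<in> W 0" "u' \<in> W 0" "v \<in> W 1" "v' \<in> W 1"
    and u: "\<And>\<alpha> \<beta>. \<alpha> *s u + \<beta> *s u' = 0 \<Longrightarrow> \<alpha> = 0 \<and> \<beta> = 0"
    and v: "\<And>\<alpha> \<beta>. \<alpha> *s v + \<beta> *s v' = 0 \<Longrightarrow> \<alpha> = 0 \<and> \<beta> = 0"
    and x: "x = (u + s *s u') + r *s (v + s *s v')" "\<And>s. s < d \<Longrightarrow> x \<notin> U s"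
    and F: "F \<in> V" "\<And>l. dir_deriv F x l = 0"
  shows "F \<in> piece V 3 (\<lambda>_ t. (u + t 0 *s u') + t 1 *s (v + t 0 *s v'))
    (\<lambda>i t. if i = 0 then (u + t 0 *s u') + t 1 *s (v + t 0 *s v') else if i = 1 then u' else v')"
proof -
  define a where "a = u + s *s u'"
  define b' where "b' = v + s *s v'"
  have xab: "x = a + r *s b'" using x by (simp add: a_def b'_def)
  have W: "vec.subspace (W 0)" "vec.subspace (W 1)" "W 0 \<inter> W 1 \<subseteq> {0}" "U 0 = W 0" "U 1 = W 1" "0 < d" "1 < d"
    using k k_le plane skew[of 0 1] by (auto simp: U_def)
  have ab: "a \<in> W 0" "b' \<in> W 1" unfolding a_def b'_def
    using W uv by (auto intro!: vec.subspace_add vec.subspace_scale)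
  define l where "l i = (if i = 0 then x else if i = 1 then u' else v')" for i :: nat
  have indep: "\<forall>i<3. \<mu> i = 0" if \<mu>: "\<forall>G\<in>V. (\<Sum>i<3. \<mu> i * dir_deriv G x (l i)) = 0" for \<mu>
  proof -
    define w where "w = (\<Sum>i<3. \<mu> i *s l i)"
    have w: "dir_deriv G x w = 0" if "G \<in> V" for G
      unfolding w_def dir_deriv_combine using \<mu> that by blast
    have w': "w = \<mu> 0 *s x + \<mu> 1 *s u' + \<mu> 2 *s v'"
      by (simp add: w_def l_def numeral_3_eq_3 numeral_2_eq_2)
    obtain w0 c where w0: "w0 \<in> W 0" "w = w0 + c *s x"
      using tangent_vanishing[OF W(6) x(2) w] span_insert_subspace[OF subspace_U] W(4) by metis
    obtain w1 c' where w1: "w1 \<in> W 1" "w = w1 + c' *s x"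
      using tangent_vanishing[OF W(7) x(2) w] span_insert_subspace[OF subspace_U] W(5) by metis
    \<comment> \<open>With the terms in \<open>W 1\<close> on the left and those in
      \<open>W 0\<close> on the right, both sides vanish by skewness.\<close>
    have "((\<mu> 0 - c) * r) *s b' + \<mu> 2 *s v' = w0 - \<mu> 1 *s u' - (\<mu> 0 - c) *s a"
      using w0(2)[unfolded w' xab] by (simp add: vec_eq_iff algebra_simps)
    moreover have "((\<mu> 0 - c) * r) *s b' + \<mu> 2 *s v' \<in> W 1"
      using W ab uv by (intro vec.subspace_add vec.subspace_scale)
    moreover have "w0 - \<mu> 1 *s u' - (\<mu> 0 - c) *s a \<in> W 0"
      using W ab uv w0 by (intro vec.subspace_diff vec.subspace_scale)
    ultimately have "((\<mu> 0 - c) * r) *s b' + \<mu> 2 *s v' = 0" using W(3) by auto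
    then have "((\<mu> 0 - c) * r) *s v + ((\<mu> 0 - c) * r * s + \<mu> 2) *s v' = 0"
      by (simp add: b'_def vec_eq_iff algebra_simps)
    from v[OF this] have \<mu>2: "\<mu> 2 = 0" by auto
    have "(\<mu> 0 - c') *s a + \<mu> 1 *s u' = w1 - \<mu> 2 *s v' - ((\<mu> 0 - c') * r) *s b'"
      using w1(2)[unfolded w' xab] by (simp add: vec_eq_iff algebra_simps)
    moreover have "(\<mu> 0 - c') *s a + \<mu> 1 *s u' \<in> W 0"
      using W ab uv by (intro vec.subspace_add vec.subspace_scale)
    moreover have "w1 - \<mu> 2 *s v' - ((\<mu> 0 - c') * r) *s b' \<in> W 1"
      using W ab uv w1 by (intro vec.subspace_diff vec.subspace_scale)
    ultimately have "(\<mu> 0 - c') *s a + \<mu> 1 *s u' = 0" using W(3) by auto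
    then have "(\<mu> 0 - c') *s u + ((\<mu> 0 - c') * s + \<mu> 1) *s u' = 0"
      by (simp add: a_def vec_eq_iff algebra_simps)
    from u[OF this] have \<mu>1: "\<mu> 1 = 0" by auto
    obtain G where G: "G \<in> V" "eval_cpoly (($) x) G \<noteq> 0" using nonvanishing_section[OF x(2)] by blast
    have "\<mu> 0 * (of_nat d * eval_cpoly (($) x) G) = 0"
      using w[OF G(1)] by (simp add: w' \<mu>1[unfolded One_nat_def] \<mu>2 dir_deriv_smult dir_deriv_euler[OF V_homogeneous[OF G(1)]])
    then have "\<mu> 0 = 0" using G(2) W(6) by simp
    then show ?thesis using \<mu>1 \<mu>2 by (auto simp: numeral_3_eq_3 less_Suc_eq numeral_2_eq_2)
  qed
  let ?t = "\<lambda>i::nat. if i = 0 then s else r"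
  have xt: "(u + ?t 0 *s u') + ?t 1 *s (v + ?t 0 *s v') = x" unfolding x(1) by simp
  show ?thesis unfolding piece_def
    using F indep unfolding l_def by (intro CollectI conjI exI[of _ ?t], unfold xt) auto
qed

text \<open>For \<open>k < d\<close> the unconstrained factor \<open>k\<close> makes every point
  generic. For \<open>k = d\<close> a non-radial \<open>l\<close> spans with \<open>x\<close> a
  transversal of all the lines. \<open>W 2\<close> is the graph of an isomorphism from
  \<open>W 0\<close> to \<open>W 1\<close> taking \<open>u1\<close>, \<open>u2\<close> to
  \<open>v1\<close>, \<open>v2\<close>, so a transversal of the first three lines joins
  corresponding points \<open>p u1 + q u2\<close> and \<open>p v1 + q v2\<close>.\<close>

lemma thin_singular_at_special_point:
  "thin J (Poly_Mapping.lookup ` {F \<in> V. \<exists>x. (\<forall>s<d. x \<notin> U s) \<and> \<not> generic_point x \<and>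
     (\<forall>l. dir_deriv F x l = 0)})" (is "thin J (_ ` ?B)")
proof (cases "k = d")
  case False
  have "generic_point x" for x
    unfolding generic_point_def
  proof (intro allI impI)
    fix l assume "\<forall>s<d. l \<in> vec.span (insert x (U s))"
    then have "l \<in> vec.span (insert x (U k))" using False k_le by simp
    then obtain w c where "w \<in> U k" "l = w + c *s x"
      unfolding span_insert_subspace[OF subspace_U] by blast
    then show "\<exists>e. l = e *s x" by (auto simp: U_def)
  qed
  then have "?B = {}" by blast
  then show ?thesis by (simp only: image_empty thin_empty)
next
  case True
  have k: "0 < k" "1 < k" "2 < k" using True d_ge by auto
  note W = plane(1)[OF k(1)] plane(1)[OF k(2)] plane(1)[OF k(3)]
  have meet: "w = 0" if "w \<in> W s" "w \<in> W s'" "s < k" "s' < k" "s \<noteq> s'" for w s s'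
    using skew[OF that(3-5)] that by blast
  obtain y1 y2 where y: "y1 \<in> W 2" "y2 \<in> W 2"
    "\<And>\<alpha> \<beta>. \<alpha> *s y1 + \<beta> *s y2 = 0 \<Longrightarrow> \<alpha> = 0 \<and> \<beta> = 0"
    "\<And>w. w \<in> W 2 \<Longrightarrow> \<exists>\<alpha> \<beta>. w = \<alpha> *s y1 + \<beta> *s y2"
    using dim2_basis[OF plane[OF k(3)]] by metis
  have sk: "W 0 \<inter> W 1 \<subseteq> {0}" using skew k by simp
  obtain u1 v1 where uv1: "u1 \<in> W 0" "v1 \<in> W 1" "y1 = u1 + v1"
    using complementary_planes[OF plane[OF k(1)] plane[OF k(2)] sk] by metis
  obtain u2 v2 where uv2: "u2 \<in> W 0" "v2 \<in> W 1" "y2 = u2 + v2"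
    using complementary_planes[OF plane[OF k(1)] plane[OF k(2)] sk] by metis
  have comb: "\<alpha> *s y1 + \<beta> *s y2 = (\<alpha> *s u1 + \<beta> *s u2) + (\<alpha> *s v1 + \<beta> *s v2)" for \<alpha> \<beta>
    unfolding uv1 uv2 by (simp add: vec_eq_iff algebra_simps)
  have mem: "\<alpha> *s u1 + \<beta> *s u2 \<in> W 0" "\<alpha> *s v1 + \<beta> *s v2 \<in> W 1" "\<alpha> *s y1 + \<beta> *s y2 \<in> W 2" for \<alpha> \<beta>
    by (intro vec.subspace_add vec.subspace_scale W uv1(1,2) uv2(1,2) y(1,2))+
  have u: "\<alpha> = 0 \<and> \<beta> = 0" if "\<alpha> *s u1 + \<beta> *s u2 = 0" for \<alpha> \<beta>
  proof -
    have "\<alpha> *s y1 + \<beta> *s y2 \<in> W 1" unfolding comb that using mem(2) by simp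
    with mem(3) have "\<alpha> *s y1 + \<beta> *s y2 = 0" by (rule meet) (use k in auto)
    then show ?thesis by (rule y(3))
  qed
  have v: "\<alpha> = 0 \<and> \<beta> = 0" if "\<alpha> *s v1 + \<beta> *s v2 = 0" for \<alpha> \<beta>
  proof -
    have "\<alpha> *s y1 + \<beta> *s y2 \<in> W 0" unfolding comb that using mem(1) by simp
    with mem(3) have "\<alpha> *s y1 + \<beta> *s y2 = 0" by (rule meet) (use k in auto)
    then show ?thesis by (rule y(3))
  qed
  have u': "\<alpha> = 0 \<and> \<beta> = 0" if "\<alpha> *s u2 + \<beta> *s u1 = 0" for \<alpha> \<beta>
    using u[of \<beta> \<alpha>] that by (simp add: add.commute)
  have v': "\<alpha> = 0 \<and> \<beta> = 0" if "\<alpha> *s v2 + \<beta> *s v1 = 0" for \<alpha> \<beta>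
    using v[of \<beta> \<alpha>] that by (simp add: add.commute)
  define P where "P u u' v v' = piece V 3 (\<lambda>_ t. (u + t 0 *s u') + t 1 *s (v + t 0 *s v'))
    (\<lambda>i t. if i = 0 then (u + t 0 *s u') + t 1 *s (v + t 0 *s v') else if i = 1 then u' else v')"
    for u u' v v' :: "complex ^ 4"
  have thin: "thin J (Poly_Mapping.lookup ` P u u' v v')" for u u' v v'
    unfolding P_def
  proof (rule thin_piece[OF coord, where m = 2])
    fix i :: nat and j
    show "(\<lambda>t. (if i = 0 then u + t 0 *s u' + t 1 *s (v + t 0 *s v') else if i = 1 then u' else v') $ j) \<in> polyf 2"
      by (cases "i = 0"; cases "i = 1") (auto intro!: polyf.intros)
  qed (auto intro!: polyf.intros)
  \<comment> \<open>Two charts for the ratio of \<open>p\<close> and \<open>q\<close>. Along the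
    transversal one chart is enough, since the missing point lies on \<open>W 1\<close> while
    \<open>x\<close> does not.\<close>
  have "?B \<subseteq> P u1 u2 v1 v2 \<union> P u2 u1 v2 v1"
  proof
    fix F assume FB: "F \<in> ?B"
    then have F: "F \<in> V" by simp
    from FB obtain x where x: "\<And>s. s < d \<Longrightarrow> x \<notin> U s" "\<not> generic_point x"
      and sing: "\<And>l. dir_deriv F x l = 0" by blast
    from x(2) obtain l where l: "\<And>s. s < d \<Longrightarrow> l \<in> vec.span (insert x (U s))" "\<And>e. l \<noteq> e *s x"
      unfolding generic_point_def by blast
    have lw: "\<exists>w\<in>W s. \<exists>c. l = w + c *s x" if "s < k" for s
    proof -
      have "U s = W s" "s < d" using that k_le by (simp_all add: U_def)
      then show ?thesis using l(1)[of s] span_insert_subspace[OF subspace_U, of l x s] by simp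
    qed
    obtain w0 c0 where w0: "w0 \<in> W 0" "l = w0 + c0 *s x" using lw[OF k(1)] by blast
    obtain w1 c1 where w1: "w1 \<in> W 1" "l = w1 + c1 *s x" using lw[OF k(2)] by blast
    obtain w2 c2 where w2: "w2 \<in> W 2" "l = w2 + c2 *s x" using lw[OF k(3)] by blast
    \<comment> \<open>Equal coefficients of \<open>x\<close> would put one vector into two skew
      planes; it would be zero and \<open>l\<close> radial.\<close>
    have ne: False if "w \<in> W s" "w' \<in> W s'" "l = w + c *s x" "l = w' + c *s x" "s < k" "s' < k" "s \<noteq> s'"
      for w w' s s' c
    proof -
      have "w = w'" using that(3,4) by simp
      then have "w = 0" using meet that by blast
      then show False using that(3) l(2) by simp
    qed
    have c: "c1 - c0 \<noteq> 0" "c1 - c2 \<noteq> 0" "c0 - c2 \<noteq> 0"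
      using ne[OF w0(1) w1(1) w0(2)] ne[OF w1(1) w2(1) w1(2)] ne[OF w0(1) w2(1) w0(2)] w1 w2 k by auto
    obtain p q where pq: "w2 = p *s y1 + q *s y2" using y(4)[OF w2(1)] by blast
    define a where "a = p *s u1 + q *s u2"
    define e where "e = p *s v1 + q *s v2"
    have w2': "w2 = a + e" using pq comb by (simp add: a_def e_def)
    define m0 where "m0 = c1 - c0"
    define m1 where "m1 = c1 - c2"
    define m2 where "m2 = c0 - c2"
    have m: "m0 \<noteq> 0" "m1 \<noteq> 0" "m2 \<noteq> 0" using c by (simp_all add: m0_def m1_def m2_def)
    \<comment> \<open>The first equation eliminates \<open>l\<close> and the second both
      \<open>l\<close> and \<open>x\<close>. Comparing components in \<open>W 0\<close> and
      \<open>W 1\<close> then identifies \<open>w0\<close> and \<open>w1\<close>, up to factors,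
      with the components \<open>a\<close> and \<open>e\<close> of \<open>w2\<close>.\<close>
    have x01: "m0 *s x = w0 - w1" and
      x012: "m0 *s w2 = m1 *s w0 - m2 *s w1"
    proof -
      have w: "w0 = l - c0 *s x" "w1 = l - c1 *s x" "w2 = l - c2 *s x"
        by (simp add: w0(2)) (simp add: w1(2), simp add: w2(2))
      show "m0 *s x = w0 - w1" "m0 *s w2 = m1 *s w0 - m2 *s w1"
        unfolding w m0_def m1_def m2_def by (simp_all add: vec_eq_iff algebra_simps)
    qed
    have eq: "m0 *s a - m1 *s w0 = - (m0 *s e + m2 *s w1)"
      using x012 unfolding w2' by (simp add: vec_eq_iff algebra_simps)
    have "m0 *s a - m1 *s w0 \<in> W 0"
      unfolding a_def using W mem w0 by (intro vec.subspace_diff vec.subspace_scale)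
    moreover have "m0 *s a - m1 *s w0 \<in> W 1"
      unfolding eq e_def using W uv1 uv2 w1 by (intro vec.subspace_neg vec.subspace_add vec.subspace_scale)
    ultimately have zero: "m0 *s a - m1 *s w0 = 0" by (rule meet) (use k in auto)
    have zero': "m0 *s e + m2 *s w1 = 0"
      using eq unfolding zero by (metis neg_equal_0_iff_equal)
    define r where "r = m1 / m2"
    have xr: "m1 *s x = a + r *s e"
      unfolding vec_eq_iff
    proof
      fix i
      have 1: "m0 * x $ i = w0 $ i - w1 $ i" using arg_cong[OF x01, of "\<lambda>v. v $ i"] by simp
      have 2: "m0 * a $ i = m1 * w0 $ i" using arg_cong[OF zero, of "\<lambda>v. v $ i"] by simp
      have 3: "m0 * e $ i = - (m2 * w1 $ i)"
        using arg_cong[OF zero', of "\<lambda>v. v $ i"] by (simp add: eq_neg_iff_add_eq_0)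
      have "m0 * (m1 * x $ i) = m1 * (m0 * x $ i)" by simp
      also have "\<dots> = m1 * w0 $ i + r * - (m2 * w1 $ i)" unfolding 1 using m by (simp add: r_def algebra_simps)
      also have "\<dots> = m0 * a $ i + r * (m0 * e $ i)" unfolding 2 3 ..
      also have "\<dots> = m0 * (a $ i + r * e $ i)" by (simp add: algebra_simps)
      finally show "(m1 *s x) $ i = (a + r *s e) $ i" using m(1) by simp
    qed
    have sc: "(e' *s x) \<notin> U s" if "s < d" "e' \<noteq> 0" for e' s
    proof
      assume "e' *s x \<in> U s"
      then have "(1 / e') *s (e' *s x) \<in> U s" by (rule vec.subspace_scale[OF subspace_U])
      moreover have "(1 / e') *s (e' *s x) = x" using that(2) by (simp add: vec_eq_iff)
      ultimately show False using x(1)[OF that(1)] by metis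
    qed
    have sing': "dir_deriv F (e' *s x) l = 0" if "e' \<noteq> 0" for e' l
      by (rule dir_deriv_scale_point[OF V_homogeneous[OF F] sing that])
    have "p \<noteq> 0 \<or> q \<noteq> 0"
    proof (rule ccontr)
      assume "\<not> ?thesis"
      then have "m1 *s x = 0" using xr by (simp add: a_def e_def)
      then have "x = 0" using m by simp
      then show False using x(1)[of 0] d_ge vec.subspace_0[OF subspace_U] by simp
    qed
    then show "F \<in> P u1 u2 v1 v2 \<union> P u2 u1 v2 v1"
    proof (cases "p = 0")
      case False
      have "(m1 / p) *s x = (1 / p) *s (m1 *s x)" by simp
      also have "\<dots> = (u1 + (q / p) *s u2) + r *s (v1 + (q / p) *s v2)"
        unfolding xr a_def e_def using False by (simp add: vec_eq_iff field_simps)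
      finally have "F \<in> P u1 u2 v1 v2" unfolding P_def
        by (rule quadric_piece[rotated 7])
          (use k m False sc sing' F uv1 uv2 u v in auto)
      then show ?thesis ..
    next
      case True
      then have q: "q \<noteq> 0" using \<open>p \<noteq> 0 \<or> q \<noteq> 0\<close> by simp
      have "(m1 / q) *s x = (1 / q) *s (m1 *s x)" by simp
      also have "\<dots> = (u2 + 0 *s u1) + r *s (v2 + 0 *s v1)"
        unfolding xr a_def e_def using q True by (simp add: vec_eq_iff field_simps)
      finally have "F \<in> P u2 u1 v2 v1" unfolding P_def
        by (rule quadric_piece[rotated 7])
          (use k m q sc sing' F uv1 uv2 u' v' in auto)
      then show ?thesis ..
    qed
  qed
  then show ?thesis by (rule thin_subset[OF thin_Un[OF thin thin] image_mono[THEN subset_trans[OF _ eq_refl[OF image_Un]]]])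
qed

end

section \<open>The open set of good forms\<close>

context line_configuration
begin

text \<open>Derivatives are tested at all nonzero vectors, not just at zeros of \<open>F\<close>:
  for a form of degree \<open>d\<close>, Euler's identity makes any point where all derivatives
  vanish a zero.\<close>

definition good :: "4 cpoly \<Rightarrow> bool" where
  "good F \<longleftrightarrow> (\<forall>x. x \<noteq> 0 \<longrightarrow> (\<exists>l. dir_deriv F x l \<noteq> 0)) \<and>
    (\<forall>L. vec.subspace L \<longrightarrow> vec.dim L = 2 \<longrightarrow> (\<forall>s<k. L \<inter> W s \<subseteq> {0}) \<longrightarrow>
      (\<exists>x\<in>L. eval_cpoly (($) x) F \<noteq> 0))"

text \<open>If \<open>V\<close> were zero, every direction at a point of \<open>W 0\<close> would
  satisfy \<open>tangent_vanishing\<close>, and \<open>W 0\<close> would be the whole space.\<close>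

lemma V_nontrivial: "\<exists>F\<in>V. F \<noteq> 0"
proof (rule ccontr)
  assume V: "\<not> ?thesis"
  obtain x y where xy: "x \<in> W 0" "\<And>\<alpha> \<beta>. \<alpha> *s x + \<beta> *s y = 0 \<Longrightarrow> \<alpha> = 0 \<and> \<beta> = 0"
    using dim2_basis[OF plane[OF k_pos]] by metis
  have x0: "x \<noteq> 0" using xy(2)[of 1 0] by auto
  have "l \<in> W 0" for l
  proof -
    have "l \<in> vec.span (insert x (U 0))"
    proof (rule tangent_vanishing)
      show "0 < d" using d_ge by simp
      show "x \<notin> U s" if "s \<noteq> 0" for s
        using U_disjoint[OF that, of x] xy x0 k_pos by (auto simp: U_def)
      show "dir_deriv F x l = 0" if "F \<in> V" for F
      proof -
        have "F = 0" using that V by blast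
        then show ?thesis by (simp add: dir_deriv_def partial_cpoly_def)
      qed
    qed
    then show ?thesis using xy(1) k_pos plane(1)[OF k_pos]
      by (metis U_def insert_absorb vec.span_eq_iff)
  qed
  then have "W 0 = UNIV" by blast
  then show False using plane(2)[OF k_pos] by (simp add: vec.dimension_def card_cart_basis)
qed

text \<open>\<open>G\<close> is the form supplied by \<open>thin_avoiding_form\<close> for the union
  of the bad families. The clause \<open>n \<ge> 1\<close> makes \<open>G\<close> vanish at the zero
  form, so that its nonvanishing produces a point of the projective space of
  \<open>V\<close>.\<close>

theorem general_form_good:
  "\<exists>n G. homogeneous n G \<and> (\<exists>F\<in>V. eval_cpoly (Poly_Mapping.lookup F) G \<noteq> 0) \<and> n \<ge> 1 \<and>
    (\<forall>F\<in>V. eval_cpoly (Poly_Mapping.lookup F) G \<noteq> 0 \<longrightarrow> good F)"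
proof -
  have "(\<Union>F\<in>V. Poly_Mapping.keys F) \<subseteq> (\<Union>F\<in>{F::4 cpoly. homogeneous d F}. Poly_Mapping.keys F)"
    using V_homogeneous by blast
  then have "finite (\<Union>F\<in>V. Poly_Mapping.keys F)"
    using finite_homogeneous_support finite_subset by blast
  then show ?thesis
  proof (rule echelon_basis[OF _ V_add V_scale V_zero])
    fix J b
    assume J: "finite J" "\<And>j. j \<in> J \<Longrightarrow> b j \<in> V"
      "\<And>i j. i \<in> J \<Longrightarrow> j \<in> J \<Longrightarrow> Poly_Mapping.lookup (b j) i = (if i = j then 1 else 0)"
      "\<And>F. F \<in> V \<Longrightarrow> F = (\<Sum>j\<in>J. fs_scale (Poly_Mapping.lookup F j) (b j))"
    interpret coordinatized_configuration d k W J b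
      by unfold_locales (rule J(1), erule J(2), erule J(4))
    have "J \<noteq> {}" using V_nontrivial J(4) by (metis sum.empty)
    define C1 where "C1 = Poly_Mapping.lookup ` {F \<in> V. \<exists>L. vec.subspace L \<and> vec.dim L = 2 \<and>
       (\<forall>s<k. L \<inter> W s \<subseteq> {0}) \<and> (\<forall>x\<in>L. eval_cpoly (($) x) F = 0)}"
    define C2 where "C2 = (\<Union>s\<in>{..<k}. Poly_Mapping.lookup `
      {F \<in> V. \<exists>x\<in>W s. x \<noteq> 0 \<and> (\<forall>l. dir_deriv F x l = 0)})"
    define C3 where "C3 = Poly_Mapping.lookup ` {F \<in> V. \<exists>x p. x $ p = 1 \<and> (\<forall>s<d. x \<notin> U s) \<and>
       generic_point x \<and> (\<forall>l. dir_deriv F x l = 0)}"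
    define C4 where "C4 = Poly_Mapping.lookup ` {F \<in> V. \<exists>x. (\<forall>s<d. x \<notin> U s) \<and> \<not> generic_point x \<and>
       (\<forall>l. dir_deriv F x l = 0)}"
    have "thin J C2" unfolding C2_def by (rule thin_UN) (use thin_singular_on_line in auto)
    moreover have "thin J C1" unfolding C1_def by (rule thin_with_line)
    moreover have "thin J C3" unfolding C3_def by (rule thin_singular_at_generic_point)
    moreover have "thin J C4" unfolding C4_def by (rule thin_singular_at_special_point)
    ultimately have "thin J (C1 \<union> C2 \<union> C3 \<union> C4)" by (intro thin_Un)
    then obtain D A g c where
      D: "D \<ge> 1" and A: "finite A" "A \<subseteq> exponents J D" and
      van: "\<forall>c\<in>C1 \<union> C2 \<union> C3 \<union> C4. (\<Sum>m\<in>A. g m * (\<Prod>j\<in>J. c j ^ Poly_Mapping.lookup m j)) = 0" and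
      c: "(\<Sum>m\<in>A. g m * (\<Prod>j\<in>J. c j ^ Poly_Mapping.lookup m j)) \<noteq> 0"
      by (rule thin_avoiding_form[OF _ J(1) \<open>J \<noteq> {}\<close>])
    define G where "G = (\<Sum>m\<in>A. Poly_Mapping.single m (g m))"
    have G: "eval_cpoly y G = (\<Sum>m\<in>A. g m * (\<Prod>j\<in>J. y j ^ Poly_Mapping.lookup m j))" for y
      unfolding G_def eval_cpoly_sum eval_cpoly_single
    proof (intro sum.cong refl)
      fix m assume "m \<in> A"
      then have "Poly_Mapping.keys m \<subseteq> J" using A(2) by (auto simp: exponents_def)
      then show "g m * mono_eval y m = g m * (\<Prod>j\<in>J. y j ^ Poly_Mapping.lookup m j)"
        using mono_eval_superset[OF J(1)] by simp
    qed
    have "homogeneous D G" unfolding G_def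
    proof (intro homogeneous_sum)
      fix m assume "m \<in> A"
      then show "homogeneous D (Poly_Mapping.single m (g m))"
        using A(2) exponent_sum_superset[OF J(1), of m] by (auto simp: homogeneous_def exponents_def)
    qed
    moreover have "\<exists>F\<in>V. eval_cpoly (Poly_Mapping.lookup F) G \<noteq> 0"
    proof
      let ?F = "\<Sum>j\<in>J. fs_scale (c j) (b j)"
      have "(\<Sum>j\<in>A. fs_scale (c j) (b j)) \<in> V" if "A \<subseteq> J" for A
        using finite_subset[OF that J(1)] that
        by (induction A rule: finite_induct) (auto intro: V_zero V_add V_scale J(2))
      then show "?F \<in> V" by blast
      have "Poly_Mapping.lookup ?F i = c i" if "i \<in> J" for i
      proof -
        have "Poly_Mapping.lookup ?F i = (\<Sum>j\<in>J. if j = i then c j else 0)"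
          unfolding lookup_sum lookup_fs_scale by (rule sum.cong) (use J(3) that in auto)
        then show ?thesis using that J(1) by simp
      qed
      then show "eval_cpoly (Poly_Mapping.lookup ?F) G \<noteq> 0" using c unfolding G by simp
    qed
    moreover have "good F" if F: "F \<in> V" "eval_cpoly (Poly_Mapping.lookup F) G \<noteq> 0" for F
    proof (rule ccontr)
      assume "\<not> good F"
      \<comment> \<open>A form that is not good either contains a line disjoint from all the given
        ones or has a singular point; the latter lies on a given line, or off them and is generic or
        special.\<close>
      have "Poly_Mapping.lookup F \<in> C1 \<union> C2 \<union> C3 \<union> C4"
      proof (cases "\<exists>x. x \<noteq> 0 \<and> (\<forall>l. dir_deriv F x l = 0)")
        case False
        then have "Poly_Mapping.lookup F \<in> C1"
          using \<open>\<not> good F\<close> F(1) unfolding good_def C1_def by blast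
        then show ?thesis by blast
      next
        case True
        then obtain x where x: "x \<noteq> 0" "\<And>l. dir_deriv F x l = 0" by blast
        show ?thesis
        proof (cases "\<exists>s<d. x \<in> U s")
          case True
          then obtain s where "s < k" "x \<in> W s" using x(1) by (auto simp: U_def split: if_splits)
          then have "Poly_Mapping.lookup F \<in> C2" using x F(1) unfolding C2_def by blast
          then show ?thesis by blast
        next
          case False
          obtain p where p: "x $ p \<noteq> 0" using x(1) by (metis vec_eq_iff zero_index)
          define z where "z = (1 / x $ p) *s x"
          have "z $ p = 1" using p by (simp add: z_def)
          moreover have "\<forall>l. dir_deriv F z l = 0" unfolding z_def
            using dir_deriv_scale_point[OF V_homogeneous[OF F(1)] x(2)] p by simp
          moreover have "\<forall>s<d. z \<notin> U s"
          proof (intro allI impI notI)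
            fix s assume "s < d" "z \<in> U s"
            then have "(x $ p) *s z \<in> U s" by (intro vec.subspace_scale subspace_U)
            then show False using False p \<open>s < d\<close> by (simp add: z_def)
          qed
          ultimately have "Poly_Mapping.lookup F \<in> C3 \<union> C4"
            using F(1) unfolding C3_def C4_def by blast
          then show ?thesis by blast
        qed
      qed
      then show False using van F(2) unfolding G by blast
    qed
    ultimately show ?thesis using D by blast
  qed
qed

end

section \<open>Passage to projective space\<close>

lemma disjoint_lines_inter:
  assumes "disjnt (projectivization (*s) W) (projectivization (*s) W')"
  shows "W \<inter> W' \<subseteq> {0}"
proof
  fix x assume "x \<in> W \<inter> W'"
  show "x \<in> {0}"
  proof (rule ccontr)
    assume "x \<notin> {0}"
    then have "proj_class (*s) x \<in> projectivization (*s) W \<inter> projectivization (*s) W'"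
      using \<open>x \<in> W \<inter> W'\<close> by (auto simp: projectivization_def)
    then show False using assms by (auto simp: disjnt_def)
  qed
qed

lemma mem_proj_class_self: "x \<in> proj_class (*s) (x :: complex ^ 'n)"
  unfolding proj_class_def by (intro CollectI exI[of _ 1]) simp

text \<open>The origin belongs to \<open>W\<close> but to no projective point;
  \<open>n \<ge> 1\<close> takes care of it.\<close>

lemma vanishing_on_projectivization:
  assumes "vec.subspace W" "homogeneous n F" "n \<ge> 1"
  shows "(\<forall>p\<in>projectivization (*s) W. \<forall>x\<in>p. eval_cpoly (($) x) F = 0) \<longleftrightarrow>
    (\<forall>x\<in>W. eval_cpoly (($) x) F = 0)"
proof safe
  fix x assume F: "\<forall>p\<in>projectivization (*s) W. \<forall>x\<in>p. eval_cpoly (($) x) F = 0" and x: "x \<in> W"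
  show "eval_cpoly (($) x) F = 0"
  proof (cases "x = 0")
    case True
    then have "($) x = (\<lambda>i. 0 * x $ i)" by auto
    then have "eval_cpoly (($) x) F = 0 ^ n * eval_cpoly (($) x) F"
      by (metis eval_cpoly_homogeneous[OF assms(2)])
    then show ?thesis using assms(3) by (simp add: power_0_left)
  next
    case False
    then show ?thesis using F x mem_proj_class_self[of x] by (auto simp: projectivization_def)
  qed
next
  fix p x assume "\<forall>x\<in>W. eval_cpoly (($) x) F = 0" "p \<in> projectivization (*s) W" "x \<in> p"
  then show "eval_cpoly (($) x) F = 0"
    using assms(1) by (auto simp: projectivization_def proj_class_def vec.subspace_scale)
qed

theorem theorem1p3:
  fixes d k :: nat and \<L> :: "(complex ^ 4) set set set" and E :: "(complex ^ 4) set set"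
  assumes "d \<ge> k" and "k > 0" and "d \<ge> 4"
    and "finite \<L>" and "card \<L> = k"
    and "\<forall>L\<in>\<L>. is_line L"
    and "pairwise disjnt \<L>"
    and "E = \<Union>\<L>"
  shows "general_member E d (\<lambda>Y.
           Y \<in> degree_surfaces d \<and> smooth_surface Y \<and> E \<subseteq> surface_points Y \<and>
           (\<forall>L. is_line L \<and> L \<inter> E = {} \<longrightarrow> \<not> L \<subseteq> surface_points Y))"
proof -
  obtain h where h: "bij_betw h {0..<k} \<L>"
    using ex_bij_betw_nat_finite[OF assms(4)] assms(5) by blast
  have "\<forall>s. \<exists>W. s < k \<longrightarrow> vec.subspace W \<and> vec.dim W = 2 \<and> h s = projectivization (*s) W"
    using assms(6) h unfolding is_line_def bij_betw_def by (metis atLeastLessThan_iff imageI zero_le)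
  from choice[OF this] obtain W where
    W: "\<And>s. s < k \<Longrightarrow> vec.subspace (W s) \<and> vec.dim (W s) = 2 \<and> h s = projectivization (*s) (W s)" by blast
  have E: "E = (\<Union>s<k. projectivization (*s) (W s))"
    using assms(8) h W by (auto simp: bij_betw_def)
  interpret line_configuration d k W
  proof
    fix s s' assume s: "s < k" "s' < k" "s \<noteq> s'"
    then have "h s \<noteq> h s'" "h s \<in> \<L>" "h s' \<in> \<L>" using h by (auto simp: bij_betw_def inj_on_def)
    then have "disjnt (h s) (h s')" using assms(7) by (auto simp: pairwise_def)
    then show "W s \<inter> W s' \<subseteq> {0}" using W s by (metis disjoint_lines_inter)
  qed (use assms W in auto)
  have sections: "ideal_sections E d = V"
    using W vanishing_on_projectivization[of _ d] d_ge unfolding ideal_sections_def V_def E by fastforce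
  obtain n G where G: "homogeneous n G" "\<exists>F\<in>V. eval_cpoly (Poly_Mapping.lookup F) G \<noteq> 0" "n \<ge> 1"
    "\<And>F. F \<in> V \<Longrightarrow> eval_cpoly (Poly_Mapping.lookup F) G \<noteq> 0 \<Longrightarrow> good F"
    using general_form_good by blast
  \<comment> \<open>The complement of one hypersurface. As \<open>G\<close> is homogeneous, its
    nonvanishing does not depend on the representative \<open>F\<close> of \<open>Y\<close>.\<close>
  define O' where "O' = {Y \<in> linear_system E d. \<exists>G'\<in>{G}. \<forall>F\<in>Y. eval_cpoly (Poly_Mapping.lookup F) G' \<noteq> 0}"
  have Gscale: "eval_cpoly (Poly_Mapping.lookup (fs_scale c F)) G = c ^ n * eval_cpoly (Poly_Mapping.lookup F) G" for c F
    using eval_cpoly_homogeneous[OF G(1), of c "Poly_Mapping.lookup F"] by (simp add: lookup_fs_scale[abs_def])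
  show ?thesis unfolding general_member_def
  proof (intro exI[of _ O'] conjI ballI)
    show "zariski_open (linear_system E d) O'"
      unfolding zariski_open_def O'_def using G(1) by (intro exI[of _ "{G}"]) auto
    obtain F where F: "F \<in> V" "eval_cpoly (Poly_Mapping.lookup F) G \<noteq> 0" using G(2) by blast
    have "F \<noteq> 0"
    proof
      assume "F = 0"
      then have "fs_scale 0 F = F" by (intro poly_mapping_eqI) (simp add: lookup_fs_scale)
      then show False using Gscale[of 0 F] G(3) F(2) by (simp add: power_0_left)
    qed
    then have "proj_class fs_scale F \<in> O'"
      using F by (auto simp: O'_def linear_system_def sections projectivization_def proj_class_def Gscale)
    then show "O' \<noteq> {}" by blast
  next
    fix Y assume "Y \<in> O'"
    then obtain F0 where Y: "Y = proj_class fs_scale F0" "F0 \<in> V" "F0 \<noteq> 0"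
      and nz: "\<And>F. F \<in> Y \<Longrightarrow> eval_cpoly (Poly_Mapping.lookup F) G \<noteq> 0"
      unfolding O'_def linear_system_def sections projectivization_def by blast
    have YV: "F \<in> V" if "F \<in> Y" for F using that Y by (auto simp: proj_class_def V_scale)
    have Ygood: "good F" if "F \<in> Y" for F using G(4) YV nz that by blast
    have F0: "F0 \<in> Y"
    proof -
      have "F0 = fs_scale 1 F0" by (rule poly_mapping_eqI) (simp add: lookup_fs_scale)
      then show ?thesis unfolding Y(1) proj_class_def by (metis (mono_tags, lifting) mem_Collect_eq one_neq_zero)
    qed
    show "Y \<in> degree_surfaces d"
      using Y V_homogeneous unfolding degree_surfaces_def projectivization_def by blast
    show "smooth_surface Y" unfolding smooth_surface_def
    proof (intro ballI)
      fix p F x assume p: "p \<in> surface_points Y" "F \<in> Y" "x \<in> p"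
      then have "x \<noteq> 0"
        by (auto simp: surface_points_def CP3_def projectivization_def proj_class_def)
      then obtain l where l: "dir_deriv F x l \<noteq> 0" using Ygood[OF p(2)] unfolding good_def by blast
      show "\<exists>i. eval_cpoly (($) x) (partial_cpoly i F) \<noteq> 0"
      proof (rule ccontr)
        assume "\<not> ?thesis"
        then show False using l by (simp add: dir_deriv_def)
      qed
    qed
    show "E \<subseteq> surface_points Y"
    proof
      fix p assume p: "p \<in> E"
      then have "p \<in> CP3" by (auto simp: E CP3_def projectivization_def)
      moreover have "eval_cpoly (($) x) F = 0" if "F \<in> Y" "x \<in> p" for F x
        using YV[OF that(1)] p that(2) unfolding sections[symmetric] ideal_sections_def by blast
      ultimately show "p \<in> surface_points Y" by (simp add: surface_points_def)
    qed
    show "\<forall>L. is_line L \<and> L \<inter> E = {} \<longrightarrow> \<not> L \<subseteq> surface_points Y"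
    proof (intro allI impI notI)
      fix L assume L: "is_line L \<and> L \<inter> E = {}" "L \<subseteq> surface_points Y"
      then obtain M where M: "vec.subspace M" "vec.dim M = 2" "L = projectivization (*s) M"
        unfolding is_line_def by blast
      have "\<forall>s<k. M \<inter> W s \<subseteq> {0}"
        using L(1) M(3) unfolding E by (intro allI impI disjoint_lines_inter) (auto simp: disjnt_def)
      then obtain x where x: "x \<in> M" "eval_cpoly (($) x) F0 \<noteq> 0"
        using Ygood[OF F0] M unfolding good_def by blast
      have "\<forall>p\<in>projectivization (*s) M. \<forall>x\<in>p. eval_cpoly (($) x) F0 = 0"
        using L(2) F0 unfolding M(3) surface_points_def by blast
      then show False
        using vanishing_on_projectivization[OF M(1) V_homogeneous[OF Y(2)]] d_ge x by simp
    qed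
  qed
qed

end
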